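(* Under the standing setting below, let $t\ge0$, $Y\in L^1_{\tilde P}(\tilde\Omega)$, and let $\varphi:\mathbb R_+^N\times\Omega\to\mathbb R$ be $\mathcal B(\mathbb R_+^N)\otimes\mathcal F_\infty$-measurable with $Y(\omega,\hat\omega)=\varphi(\boldsymbol\tau(\omega,\hat\omega),\omega)$. With $u^{\tilde\tau}_{k,l}:=u_k+\sum_{m=k+1}^l\tilde\tau_m$ ($l=k+1,\dots,N$) and $\mathbf u^{\tilde\tau}_k:=(u^{\tilde\tau}_{k,k+1},\dots,u^{\tilde\tau}_{k,N})$, we have $\tilde P$-a.s. $$\begin{aligned}\mathbb E^{\tilde P}[Y\mid\mathcal G^{(N)}_t]&=\mathbf 1_{\{t<\tau_1\}}e^{\int_0^t\tilde\lambda^1_sds}\,\mathbb E^P\big[\mathbb E^{\hat P}[\mathbf 1_{\{t<\tau_1\}}Y]\mid\mathcal F_t\big]\\&\quad+\sum_{k=1}^{N-1}\mathbf 1_{\{\tau_k\le t<\tau_{k+1}\}}e^{\int_0^{t-\tau_k}\tilde\lambda^{k+1}_sds}\,\mathbb E^P\Big[\mathbb E^{\hat P}\big[\mathbf 1_{\{\tilde\tau_{k+1}>t-u_k\}}\varphi(\mathbf u_{(k)},\mathbf u^{\tilde\tau}_k,\cdot)\big]\Big|\mathcal F_t\Big]\Big|_{\mathbf u_{(k)}=\boldsymbol\tau_{(k)}}\\&\quad+\mathbf 1_{\{\tau_N\le t\}}\,\mathbb E^P[\varphi(\mathbf u_{(N)},\cdot)\mid\mathcal F_t]\big|_{\mathbf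 u_{(N)}=\boldsymbol\tau}.\end{aligned}$$
   Context: Single-prior setting. Let $(\Omega,\mathcal F,P)$ be a probability space, $\Omega$ Polish, $\mathcal F=\mathcal B(\Omega)$, with a filtration $\mathbb F=(\mathcal F_t)_{t\ge0}$ (not assumed to satisfy the usual conditions), $\mathcal F_\infty=\bigvee_{t}\mathcal F_t$. Let $(\hat\Omega,\mathcal B(\hat\Omega),\hat P)$ be a probability space ($\hat\Omega$ Polish) carrying random variables $E_1,\dots,E_N$ which are i.i.d. unit-exponentially distributed under $\hat P$. Set $(\tilde\Omega,\mathcal G,\tilde P)=(\Omega\times\hat\Omega,\mathcal B(\Omega)\otimes\mathcal B(\hat\Omega),P\otimes\hat P)$, write $\tilde\omega=(\omega,\hat\omega)$, and identify functions and sub-$\sigma$-algebras on one factor with their natural extensions to $\tilde\Omega$ (e.g. $X(\omega,\hat\omega)=X(\omega)$, $\mathcal A\equiv\mathcal A\otimes\{\emptyset,\hat\Omega\}$); in particular the $E_n$ are independent of $\mathcal F_\infty$ under $\tilde P$. Let $\tilde\lambda^1,\dots,\tilde\lambda^N$ be nonnegative, measurable, $\mathbb F$-adapted processes on $\Omega$ with $\int_0^t\tilde\lambda^n_s ds<\infty$ for all $t<\infty$ and $\int_0^\infty\tilde\lambda^n_sds=+\infty$, $P$-a.s. Define $\tilde\tau_n=\inf\{t>0:\int_0^t\tilde\lambda^n_sds\ge E_n\}$, $\tau_n=\sum_{k=1}^n\tilde\tau_k$, $\tau_0=0$, $\tau_{N+1}=+\infty$, $\boldsymbol\tau=(\tau_1,\dots,\tau_N)$,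 $\boldsymbol\tau_{(k)}=(\tau_1,\dots,\tau_k)$; for a vector $\mathbf u$, $\mathbf u_{(k)}$ denotes its first $k$ entries. Let $\mathbb H^n=(\mathcal H^n_t)_{t\ge0}$ be the filtration generated by $(\mathbf 1_{\{\tau_n\le t\}})_{t\ge0}$, $\mathbb G^{(0)}=\mathbb F$, $\mathcal G^{(n)}_t=\mathcal F_t\vee\mathcal H^1_t\vee\cdots\vee\mathcal H^n_t$, $\mathcal G^{(n)}_\infty=\bigvee_t\mathcal G^{(n)}_t$. $L^1_{\tilde P}(\tilde\Omega)$ is the set of real random variables on $\tilde\Omega$ measurable w.r.t. $\mathcal G\vee\mathcal N^P_\infty$ ($\mathcal N^P_\infty$ = the $(P,\mathcal F_\infty)$-null sets) with $\mathbb E^{\tilde P}|X|<\infty$. For measurable $X$ on $\tilde\Omega$, $\mathbb E^{\hat P}[X](\omega):=\int_{\hat\Omega}X(\omega,\hat\omega)\hat P(d\hat\omega)$. *)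

theory Defs
  imports "HOL-Probability.Probability"
begin

definition cumhaz :: "(real \<Rightarrow> 'a \<Rightarrow> real) \<Rightarrow> real \<Rightarrow> 'a \<Rightarrow> ennreal" where
  "cumhaz l t \<omega> = (\<integral>\<^sup>+ s. indicator {0..t} s * ennreal (l s \<omega>) \<partial>lborel)"

text \<open>tilde tau_n = inf {t > 0 : int_0^t lam^n_s ds >= E_n}; the infimum of the empty set
  (a null event) is conventionally set to 0 here (the paper uses +infinity).\<close>
definition ttau :: "(nat \<Rightarrow> real \<Rightarrow> 'a \<Rightarrow> real) \<Rightarrow> (nat \<Rightarrow> 'b \<Rightarrow> real) \<Rightarrow> nat \<Rightarrow> 'a \<times> 'b \<Rightarrow> real" where
  "ttau lam E n x =
    (let S = {t. 0 < t \<and> ennreal (E n (snd x)) \<le> cumhaz (lam n) t (fst x)} in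
     if S = {} then 0 else Inf S)"

definition tau :: "(nat \<Rightarrow> real \<Rightarrow> 'a \<Rightarrow> real) \<Rightarrow> (nat \<Rightarrow> 'b \<Rightarrow> real) \<Rightarrow> nat \<Rightarrow> 'a \<times> 'b \<Rightarrow> real" where
  "tau lam E n x = (\<Sum>k=1..n. ttau lam E k x)"

definition tauvec :: "(nat \<Rightarrow> real \<Rightarrow> 'a \<Rightarrow> real) \<Rightarrow> (nat \<Rightarrow> 'b \<Rightarrow> real) \<Rightarrow> nat \<Rightarrow> 'a \<times> 'b \<Rightarrow> nat \<Rightarrow> real" where
  "tauvec lam E k x = restrict (\<lambda>n. tau lam E n x) {1..k}"

definition Finf :: "'a measure \<Rightarrow> (real \<Rightarrow> 'a measure) \<Rightarrow> 'a measure" where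
  "Finf P F = sigma (space P) (\<Union>t\<in>{0..}. sets (F t))"

text \<open>G^(N)_t = F_t \/ H^1_t \/ ... \/ H^N_t on the product space, H^n_t generated by 1{tau_n <= s}, 0 <= s <= t\<close>
definition GN :: "'a measure \<Rightarrow> 'b measure \<Rightarrow> (real \<Rightarrow> 'a measure) \<Rightarrow> (nat \<Rightarrow> real \<Rightarrow> 'a \<Rightarrow> real)
    \<Rightarrow> (nat \<Rightarrow> 'b \<Rightarrow> real) \<Rightarrow> nat \<Rightarrow> real \<Rightarrow> ('a \<times> 'b) measure" where
  "GN P Ph F lam E N t = sigma (space P \<times> space Ph)
     ({A \<times> space Ph | A. A \<in> sets (F t)} \<union>
      {{x \<in> space P \<times> space Ph. tau lam E n x \<le> s} | n s. n \<in> {1..N} \<and> 0 \<le> s \<and> s \<le> t})"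

definition uext :: "(nat \<Rightarrow> real \<Rightarrow> 'a \<Rightarrow> real) \<Rightarrow> (nat \<Rightarrow> 'b \<Rightarrow> real) \<Rightarrow> nat \<Rightarrow> nat
    \<Rightarrow> (nat \<Rightarrow> real) \<Rightarrow> 'a \<times> 'b \<Rightarrow> nat \<Rightarrow> real" where
  "uext lam E N k u x = restrict (\<lambda>l. if l \<le> k then u l else u k + (\<Sum>m=k+1..l. ttau lam E m x)) {1..N}"

end

theory Submission
  imports Defs
begin

text \<open>
  Use the waiting times (increments of the default times) as coordinates. Given \<open>\<omega>\<close>, they are
  independent, and the \<open>n\<close>-th one has the density \<open>\<lambda>\<^sup>n\<^sub>s exp (- \<Lambda>\<^sup>n\<^sub>s)\<close>; hence the law of the first
  \<open>k\<close> waiting times together with \<open>\<omega>\<close> is absolutely continuous with respect to a product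
  measure. This makes versions that are fixed only for each \<open>u\<close> separately meaningful after
  substituting \<open>u = \<tau>\<close>. On the stage \<open>\<tau>\<^sub>k \<le> t < \<tau>\<^sub>k\<^sub>+\<^sub>1\<close> every event of the enlarged filtration is an
  event in the first \<open>k\<close> waiting times and \<open>F\<^sub>t\<close>, the density of those waiting times is
  \<open>F\<^sub>t\<close>-measurable, and the survival probability of the next waiting time is
  \<open>exp (- \<Lambda>\<^sup>k\<^sup>+\<^sup>1)\<close>; conditioning on \<open>F\<^sub>t\<close> under the integral over the waiting times gives the formula.
\<close>

section \<open>Hitting times of a cumulative hazard\<close>

text \<open>The obstacle is that \<open>g k u\<close> is determined only up to a null set that may
  depend on \<open>u\<close>, and then uncountably many \<open>u\<close> are replaced by the random
  default times. Moreover \<open>g k\<close> is jointly measurable only over \<open>P\<close>,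
  whereas the conditional expectation needs measurability relative to \<open>F t\<close>, which is
  not complete. Measurability is therefore handled through \<open>AE_measurable\<close>, and
  \<open>AE_measurable_pair\<close> builds a jointly measurable representative out of the sections
  in \<open>u\<close>. Integrability is the second difficulty. Integrability of \<open>Y\<close>
  controls the conditional payoff only after multiplication by the density of the waiting times, so
  the identities keep this factor (\<open>weight\<close>). The prefactor
  \<open>exp (haz_exponent k v \<omega>)\<close> is not bounded either; it is harmless because it
  always meets the survival event, whose conditional probability is its reciprocal.\<close>

definition hit :: "(real \<Rightarrow> 'a \<Rightarrow> real) \<Rightarrow> real \<Rightarrow> 'a \<Rightarrow> real" where
  "hit l e \<omega> = (let S = {t. 0 < t \<and> ennreal e \<le> cumhaz l t \<omega>} in if S = {} then 0 else Inf S)"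

text \<open>Freeing the threshold from \<open>E\<close> allows the same facts to be used pathwise,
  with a fixed scenario and a real threshold, and jointly in both.\<close>

lemma ttau_eq_hit: "ttau lam E n x = hit (lam n) (E n (snd x)) (fst x)"
  by (simp add: ttau_def hit_def)

lemma cumhaz_mono: "s \<le> r \<Longrightarrow> cumhaz l s \<omega> \<le> cumhaz l r \<omega>"
  unfolding cumhaz_def by (intro nn_integral_mono) (auto split: split_indicator)

lemma cumhaz_nonpos:
  assumes "s \<le> 0" shows "cumhaz l s \<omega> = 0"
proof -
  have "AE x in lborel. x \<noteq> (0::real)" by (rule AE_lborel_singleton)
  then have "cumhaz l s \<omega> = (\<integral>\<^sup>+ x. 0 \<partial>(lborel :: real measure))"
    unfolding cumhaz_def
    by (intro nn_integral_cong_AE) (use assms in \<open>auto split: split_indicator\<close>)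
  then show ?thesis by simp
qed

lemma hit_nonneg: "0 \<le> hit l e \<omega>"
  unfolding hit_def Let_def by (auto intro!: cInf_greatest)

text \<open>The set of times at which the hazard has reached \<open>e\<close> is closed upwards, so
  rational times decide both whether it is empty and whether its infimum lies below
  \<open>s\<close>. This makes the event a countable combination of events and yields measurability
  of \<open>hit\<close> on all scenarios, including the exceptional ones where the hazard is
  infinite or never reaches \<open>e\<close>; the first disjunct is the default value 0 of the empty
  infimum.\<close>

lemma hit_less_iff:
  "hit l e \<omega> < s \<longleftrightarrow> 0 < s \<and>
    ((\<forall>r::rat. 0 < (of_rat r::real) \<longrightarrow> \<not> ennreal e \<le> cumhaz l (of_rat r) \<omega>) \<or>
     (\<exists>r::rat. 0 < (of_rat r::real) \<and> of_rat r < s \<and> ennreal e \<le> cumhaz l (of_rat r) \<omega>))"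
proof -
  define S where "S = {t. 0 < t \<and> ennreal e \<le> cumhaz l t \<omega>}"
  have S_up: "r \<in> S" if "q \<in> S" "q \<le> r" for q r
    using that cumhaz_mono[of q r l \<omega>] by (auto simp: S_def intro: order_trans)
  have S_rat: "\<exists>r::rat. of_rat r \<in> S \<and> of_rat r < s" if "q \<in> S" "q < s" for q s :: real
  proof -
    obtain r where "q < of_rat r" "of_rat r < s" using of_rat_dense[OF \<open>q < s\<close>] by auto
    then show ?thesis using S_up[OF \<open>q \<in> S\<close>] by (intro exI[of _ r]) auto
  qed
  have empty: "S = {} \<longleftrightarrow> (\<forall>r::rat. of_rat r \<notin> S)"
    using S_rat[of _ "_ + 1"] by (metis all_not_in_conv less_add_one)
  have bdd: "bdd_below S" by (rule bdd_belowI[of _ 0]) (auto simp: S_def)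
  have "hit l e \<omega> < s \<longleftrightarrow> 0 < s \<and> (S = {} \<or> (\<exists>q\<in>S. q < s))"
  proof (cases "S = {}")
    case True
    then show ?thesis by (simp add: hit_def S_def)
  next
    case False
    then have "hit l e \<omega> < s \<longleftrightarrow> (\<exists>q\<in>S. q < s)"
      using cInf_less_iff[OF False bdd] by (simp add: hit_def flip: S_def)
    then show ?thesis using False by (auto simp: S_def)
  qed
  also have "\<dots> \<longleftrightarrow> 0 < s \<and> ((\<forall>r::rat. of_rat r \<notin> S) \<or> (\<exists>r::rat. of_rat r \<in> S \<and> of_rat r < s))"
    using empty S_rat by blast
  finally show ?thesis unfolding S_def mem_Collect_eq by blast
qed

text \<open>The properties that almost every scenario has, stated for one path. Times below 0 are
  cut off because nothing is assumed about \<open>l\<close> there.\<close>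

locale hazard_path =
  fixes l :: "real \<Rightarrow> 'a \<Rightarrow> real" and \<omega> :: 'a
  assumes meas: "(\<lambda>s. if 0 \<le> s then l s \<omega> else 0) \<in> borel_measurable borel"
    and cumhaz_finite_nonneg: "\<And>r. 0 \<le> r \<Longrightarrow> cumhaz l r \<omega> < \<infinity>"
    and total_infinite: "(\<integral>\<^sup>+ s. indicator {0..} s * ennreal (l s \<omega>) \<partial>lborel) = \<infinity>"
begin

abbreviation haz :: "real \<Rightarrow> real" where "haz s \<equiv> if 0 \<le> s then l s \<omega> else 0"
abbreviation \<Lambda> :: "real \<Rightarrow> real" where "\<Lambda> s \<equiv> enn2real (cumhaz l s \<omega>)"

lemma haz_measurable [measurable]: "haz \<in> borel_measurable borel"
  by (rule meas)

lemma cumhaz_finite: "cumhaz l r \<omega> < \<infinity>"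
  using cumhaz_finite_nonneg[of r] cumhaz_nonpos[of r l \<omega>] by (cases "0 \<le> r") auto

lemma cumhaz_eq: "cumhaz l r \<omega> = ennreal (\<Lambda> r)"
  using cumhaz_finite[of r] by simp

lemma ennreal_le_cumhaz_iff: "ennreal e \<le> cumhaz l r \<omega> \<longleftrightarrow> e \<le> \<Lambda> r"
  by (subst cumhaz_eq) (simp add: ennreal_le_iff enn2real_nonneg)

lemma \<Lambda>_mono: "s \<le> r \<Longrightarrow> \<Lambda> s \<le> \<Lambda> r"
  using cumhaz_mono cumhaz_finite by (intro enn2real_mono) auto

text \<open>Near \<open>s\<close> the cumulative hazard is the distribution function of a finite
  measure with a Lebesgue density. Such a measure has no atoms, so its distribution function is
  continuous.\<close>

lemma isCont_\<Lambda>: "isCont \<Lambda> s"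
proof -
  \<comment> \<open>Any cut-off to the right of both \<open>s\<close> and 0 works: it makes the
    measure finite and changes nothing near \<open>s\<close>.\<close>
  define b where "b = max s 0 + 1"
  define \<mu> where "\<mu> = density lborel (\<lambda>x. indicator {0..b} x * ennreal (haz x))"
  have em: "emeasure \<mu> A = (\<integral>\<^sup>+ x. indicator {0..b} x * ennreal (haz x) * indicator A x \<partial>lborel)"
    if "A \<in> sets borel" for A
    unfolding \<mu>_def by (subst emeasure_density) (use that in auto)
  have Iic: "emeasure \<mu> {..r} = cumhaz l r \<omega>" if "r \<le> b" for r
    unfolding cumhaz_def using that
    by (subst em) (auto intro!: nn_integral_cong split: split_indicator)
  have "emeasure \<mu> UNIV = emeasure \<mu> {..b}"
    by (subst (1 2) em) (auto intro!: nn_integral_cong split: split_indicator)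
  then have "emeasure \<mu> UNIV < \<infinity>"
    using Iic[of b] cumhaz_finite[of b] by simp
  then have "finite_measure \<mu>"
    by (intro finite_measureI) (simp add: \<mu>_def)
  then interpret finite_borel_measure \<mu>
    unfolding finite_borel_measure_def finite_borel_measure_axioms_def by (simp add: \<mu>_def)
  have "emeasure \<mu> {s} = (\<integral>\<^sup>+ x. 0 \<partial>(lborel :: real measure))"
    by (subst em, simp, rule nn_integral_cong_AE,
        rule eventually_mono[OF AE_lborel_singleton[of s]]) auto
  then have "isCont (cdf \<mu>) s"
    unfolding isCont_cdf by (simp add: measure_def)
  moreover have "eventually (\<lambda>r. cdf \<mu> r = \<Lambda> r) (nhds s)"
  proof -
    have "eventually (\<lambda>r. r < b) (nhds s)"
      by (rule order_tendstoD(2)[OF filterlim_ident]) (auto simp: b_def)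
    then show ?thesis
      by eventually_elim (simp add: cdf_def measure_def Iic)
  qed
  ultimately show ?thesis by (simp cong: isCont_cong)
qed

text \<open>By continuity the infimum is attained, and it is an infimum over a nonempty set because
  the total hazard is infinite. So \<open>hit\<close> and \<open>\<Lambda>\<close> are generalized
  inverses of each other.\<close>

lemma hit_le_iff:
  assumes "0 < e"
  shows "hit l e \<omega> \<le> s \<longleftrightarrow> e \<le> \<Lambda> s"
proof -
  define S where "S = {t. 0 < t \<and> ennreal e \<le> cumhaz l t \<omega>}"
  have S_iff: "t \<in> S \<longleftrightarrow> e \<le> \<Lambda> t" for t
    using assms cumhaz_nonpos[of t l \<omega>] ennreal_le_cumhaz_iff[of e t]
    by (cases "0 < t") (auto simp: S_def)
  have "S \<noteq> {}"
  proof
    \<comment> \<open>If \<open>e\<close> were never reached, every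
      \<open>cumhaz l t \<omega>\<close> would be at most \<open>e\<close>, and monotone convergence
      along integer times would bound the total hazard by \<open>e\<close>.\<close>
    assume "S = {}"
    then have less: "cumhaz l t \<omega> \<le> ennreal e" for t
      using S_iff[of t] by (subst cumhaz_eq) (intro ennreal_leI, auto)
    have "(\<integral>\<^sup>+ s. indicator {0..} s * ennreal (l s \<omega>) \<partial>lborel)
      = (\<integral>\<^sup>+ s. (SUP n. indicator {0..real n} s * ennreal (haz s)) \<partial>lborel)"
    proof (rule nn_integral_cong)
      fix s :: real
      obtain m :: nat where m: "s \<le> real m" using real_arch_simple by blast
      have "(SUP n. indicator {0..real n} s * ennreal (haz s)) = ennreal (haz s)" if "0 \<le> s"
        by (rule antisym[OF SUP_least SUP_upper2[of m]])
           (use that m in \<open>auto split: split_indicator\<close>)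
      then show "indicator {0..} s * ennreal (l s \<omega>)
        = (SUP n. indicator {0..real n} s * ennreal (haz s))"
        by (cases "0 \<le> s") auto
    qed
    also have "\<dots> = (SUP n. \<integral>\<^sup>+ s. indicator {0..real n} s * ennreal (haz s) \<partial>lborel)"
      by (rule nn_integral_monotone_convergence_SUP)
         (auto simp: incseq_def le_fun_def split: split_indicator)
    also have "\<dots> = (SUP n. cumhaz l (real n) \<omega>)"
      unfolding cumhaz_def by (intro SUP_cong nn_integral_cong) (auto split: split_indicator)
    also have "\<dots> \<le> ennreal e" by (intro SUP_least less)
    finally show False using total_infinite by (simp add: top_unique)
  qed
  have bdd: "bdd_below S" by (rule bdd_belowI[of _ 0]) (auto simp: S_def)
  have hit: "hit l e \<omega> = Inf S" using \<open>S \<noteq> {}\<close> by (simp add: hit_def flip: S_def)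
  have "e \<le> \<Lambda> (Inf S)"
  proof (rule ccontr)
    assume "\<not> e \<le> \<Lambda> (Inf S)"
    then have "eventually (\<lambda>r. \<Lambda> r < e) (at (Inf S))"
      using order_tendstoD(2)[OF isCont_\<Lambda>[unfolded isCont_def]] by auto
    then obtain d where d: "0 < d" "\<And>r. r \<noteq> Inf S \<Longrightarrow> dist r (Inf S) < d \<Longrightarrow> \<Lambda> r < e"
      by (auto simp: eventually_at)
    obtain r where "r \<in> S" "r < Inf S + d"
      using cInf_lessD[OF \<open>S \<noteq> {}\<close>, of "Inf S + d"] \<open>0 < d\<close> by auto
    moreover have "Inf S \<le> r" using \<open>r \<in> S\<close> bdd by (rule cInf_lower)
    ultimately show False
      using d(2)[of r] S_iff[of r] \<open>\<not> e \<le> \<Lambda> (Inf S)\<close> by (cases "r = Inf S") (auto simp: dist_real_def)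
  qed
  then show ?thesis
    using \<Lambda>_mono[of "Inf S" s] S_iff[of s] cInf_lower[OF _ bdd, of s] hit by fastforce
qed

text \<open>A continuous function cannot overshoot the level at its first passage: otherwise the
  level would already be exceeded slightly earlier.\<close>

lemma \<Lambda>_hit:
  assumes "0 < e"
  shows "\<Lambda> (hit l e \<omega>) = e"
proof (rule antisym)
  show "e \<le> \<Lambda> (hit l e \<omega>)" using hit_le_iff[OF assms] by blast
  show "\<Lambda> (hit l e \<omega>) \<le> e"
  proof (rule ccontr)
    assume "\<not> \<Lambda> (hit l e \<omega>) \<le> e"
    then have "eventually (\<lambda>r. e < \<Lambda> r) (at (hit l e \<omega>))"
      using order_tendstoD(1)[OF isCont_\<Lambda>[unfolded isCont_def]] by auto
    then obtain d where d: "0 < d" "\<And>r. r \<noteq> hit l e \<omega> \<Longrightarrow> dist r (hit l e \<omega>) < d \<Longrightarrow> e < \<Lambda> r"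
      by (auto simp: eventually_at)
    then have "e < \<Lambda> (hit l e \<omega> - d / 2)" by (auto simp: dist_real_def)
    then show False using hit_le_iff[OF assms, of "hit l e \<omega> - d / 2"] d(1) by auto
  qed
qed

text \<open>Up to the single point \<open>hit l e \<omega>\<close>, the set where
  \<open>\<Lambda> x < e\<close> is the half-line to the left of the hitting time. The integral is
  thus \<open>\<Lambda>\<close> at the smaller of \<open>s\<close> and the hitting time.\<close>

lemma cumhaz_before_hit:
  assumes "0 < e"
  shows "(\<integral>\<^sup>+ x. indicator {0..s} x * ennreal (haz x) * indicator {x. \<Lambda> x < e} x \<partial>lborel)
    = ennreal (min (\<Lambda> s) e)"
proof -
  have "(\<integral>\<^sup>+ x. indicator {0..s} x * ennreal (haz x) * indicator {x. \<Lambda> x < e} x \<partial>lborel)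
      = cumhaz l (min s (hit l e \<omega>)) \<omega>"
    unfolding cumhaz_def[of l "min s (hit l e \<omega>)"]
  proof (rule nn_integral_cong_AE)
    show "AE x in lborel. indicator {0..s} x * ennreal (haz x) * indicator {x. \<Lambda> x < e} x
        = indicator {0..min s (hit l e \<omega>)} x * ennreal (l x \<omega>)"
      using AE_lborel_singleton[of "hit l e \<omega>"]
    proof eventually_elim
      case (elim x)
      then have "\<Lambda> x < e \<longleftrightarrow> x \<le> hit l e \<omega>" using hit_le_iff[OF assms, of x] by auto
      then show ?case by (auto split: split_indicator)
    qed
  qed
  also have "\<dots> = ennreal (\<Lambda> (min s (hit l e \<omega>)))" by (rule cumhaz_eq)
  also have "\<Lambda> (min s (hit l e \<omega>)) = min (\<Lambda> s) e"
    using \<Lambda>_mono[of s "hit l e \<omega>"] \<Lambda>_mono[of "hit l e \<omega>" s] \<Lambda>_hit[OF assms]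
    by (auto simp: min_def)
  finally show ?thesis .
qed

lemma \<Lambda>_measurable [measurable]: "\<Lambda> \<in> borel_measurable borel"
  by (rule borel_measurable_continuous_onI) (simp add: continuous_at_imp_continuous_on isCont_\<Lambda>)

section \<open>Exponential thresholds and the law of the hitting time\<close>

context
  fixes Q :: "'b measure" and X :: "'b \<Rightarrow> real"
  assumes Q: "prob_space Q" and X: "distributed Q lborel X (exponential_density 1)"
begin

lemma exp_rv_measurable [measurable]: "X \<in> borel_measurable Q"
  using distributed_measurable[OF X] by simp

lemma exp_rv_gt: "0 \<le> a \<Longrightarrow> emeasure Q {x \<in> space Q. a < X x} = ennreal (exp (- a))"
  using prob_space.exponential_distributedD_gt[OF Q X, of a]
  by (simp add: finite_measure.emeasure_eq_measure[OF prob_space.finite_measure[OF Q]])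

lemma exp_rv_le: "0 \<le> a \<Longrightarrow> emeasure Q {x \<in> space Q. X x \<le> a} = ennreal (1 - exp (- a))"
  using prob_space.exponential_distributedD_le[OF Q X, of a]
  by (simp add: finite_measure.emeasure_eq_measure[OF prob_space.finite_measure[OF Q]])

text \<open>Thresholds that are not positive have to be excluded: for them \<open>hit\<close> is 0,
  while \<open>e \<le> \<Lambda> s\<close> holds at negative \<open>s\<close> as well, so
  \<open>hit_le_iff\<close> fails.\<close>

lemma exp_rv_pos: "AE x in Q. 0 < X x"
proof -
  have "emeasure Q {x \<in> space Q. X x \<le> 0} = 0" using exp_rv_le[of 0] by simp
  then have "AE x in Q. \<not> X x \<le> 0" by (subst AE_iff_measurable[OF _ refl]) auto
  then show ?thesis by eventually_elim simp
qed

lemma AE_hit_le_iff: "AE x in Q. \<forall>s. hit l (X x) \<omega> \<le> s \<longleftrightarrow> X x \<le> \<Lambda> s"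
  using exp_rv_pos by eventually_elim (auto simp: hit_le_iff)

text \<open>Layer-cake formula: \<open>min a (X x)\<close> is the length of the set of
  \<open>y\<close> in \<open>{0..a}\<close> below \<open>X x\<close>, so Fubini turns the
  expectation into the integral of the tail \<open>exp (- y)\<close> over
  \<open>{0..a}\<close>.\<close>

lemma expectation_min_exp:
  assumes "0 \<le> a"
  shows "(\<integral>\<^sup>+ x. ennreal (min a (X x)) \<partial>Q) = ennreal (1 - exp (- a))"
proof -
  interpret Q: prob_space Q by (rule Q)
  interpret pair_sigma_finite Q "lborel :: real measure" ..
  have "(\<integral>\<^sup>+ x. ennreal (min a (X x)) \<partial>Q)
      = (\<integral>\<^sup>+ x. (\<integral>\<^sup>+ y. indicator {0..a} y * indicator {z. snd z < X (fst z)} (x, y) \<partial>lborel) \<partial>Q)"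
  proof (rule nn_integral_cong_AE, use exp_rv_pos in eventually_elim)
    case (elim x)
    have "(\<integral>\<^sup>+ y. indicator {0..a} y * indicator {z. snd z < X (fst z)} (x, y) \<partial>lborel)
        = (\<integral>\<^sup>+ y. indicator {0..min a (X x)} y \<partial>lborel)"
      by (rule nn_integral_cong_AE, rule eventually_mono[OF AE_lborel_singleton[of "X x"]])
         (auto split: split_indicator)
    also have "\<dots> = ennreal (min a (X x))" using elim assms by simp
    finally show ?case by simp
  qed
  also have "\<dots> = (\<integral>\<^sup>+ y. (\<integral>\<^sup>+ x. indicator {0..a} y * indicator {z. snd z < X (fst z)} (x, y) \<partial>Q) \<partial>lborel)"
    by (rule Fubini'[symmetric]) measurable
  also have "\<dots> = (\<integral>\<^sup>+ y. indicator {0..a} y * ennreal (exp (- y)) \<partial>lborel)"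
  proof (rule nn_integral_cong)
    fix y :: real
    have "(\<integral>\<^sup>+ x. indicator {0..a} y * indicator {z. snd z < X (fst z)} (x, y) \<partial>Q)
      = (\<integral>\<^sup>+ x. indicator {0..a} y * indicator {x \<in> space Q. y < X x} x \<partial>Q)"
      by (intro nn_integral_cong) (auto split: split_indicator)
    also have "\<dots> = indicator {0..a} y * emeasure Q {x \<in> space Q. y < X x}"
      by (simp add: nn_integral_cmult)
    finally show "(\<integral>\<^sup>+ x. indicator {0..a} y * indicator {z. snd z < X (fst z)} (x, y) \<partial>Q)
      = indicator {0..a} y * ennreal (exp (- y))"
      using exp_rv_gt[of y] by (auto split: split_indicator)
  qed
  also have "\<dots> = (\<integral>\<^sup>+ y. ennreal (exp (- y)) * indicator {0..a} y \<partial>lborel)"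
    by (simp add: mult.commute)
  also have "\<dots> = ennreal ((- exp (- a)) - (- exp (- 0)))"
    by (rule nn_integral_FTC_Icc) (use assms in \<open>auto intro!: derivative_eq_intros\<close>)
  finally show ?thesis by simp
qed

text \<open>Since \<open>\<Lambda>\<close> need not be differentiable, the integral is computed by Fubini: both sides are the
  expectation of \<open>\<Lambda>\<close> at the minimum of \<open>s\<close> and the hitting time.\<close>

lemma density_hazard_atMost:
  assumes "0 \<le> s"
  shows "(\<integral>\<^sup>+ y. indicator {0..s} y * ennreal (haz y * exp (- \<Lambda> y)) \<partial>lborel) = ennreal (1 - exp (- \<Lambda> s))"
proof -
  interpret Q: prob_space Q by (rule Q)
  interpret pair_sigma_finite Q "lborel :: real measure" ..
  have "(\<integral>\<^sup>+ y. indicator {0..s} y * ennreal (haz y * exp (- \<Lambda> y)) \<partial>lborel)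
     = (\<integral>\<^sup>+ y. (\<integral>\<^sup>+ x. indicator {0..s} y * ennreal (haz y) *
          indicator {z. \<Lambda> (snd z) < X (fst z)} (x, y) \<partial>Q) \<partial>lborel)"
  proof (rule nn_integral_cong)
    fix y :: real
    have "(\<integral>\<^sup>+ x. indicator {0..s} y * ennreal (haz y) * indicator {z. \<Lambda> (snd z) < X (fst z)} (x, y) \<partial>Q)
      = (\<integral>\<^sup>+ x. indicator {0..s} y * ennreal (haz y) * indicator {x \<in> space Q. \<Lambda> y < X x} x \<partial>Q)"
      by (intro nn_integral_cong) (auto split: split_indicator)
    also have "\<dots> = indicator {0..s} y * ennreal (haz y) * emeasure Q {x \<in> space Q. \<Lambda> y < X x}"
      by (subst nn_integral_cmult) auto
    also have "\<dots> = indicator {0..s} y * ennreal (haz y * exp (- \<Lambda> y))"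
      by (subst exp_rv_gt) (auto simp: ennreal_mult'' mult.assoc)
    finally show "indicator {0..s} y * ennreal (haz y * exp (- \<Lambda> y))
      = (\<integral>\<^sup>+ x. indicator {0..s} y * ennreal (haz y) * indicator {z. \<Lambda> (snd z) < X (fst z)} (x, y) \<partial>Q)"
      by simp
  qed
  also have "\<dots> = (\<integral>\<^sup>+ x. (\<integral>\<^sup>+ y. indicator {0..s} y * ennreal (haz y) *
          indicator {z. \<Lambda> (snd z) < X (fst z)} (x, y) \<partial>lborel) \<partial>Q)"
    by (rule Fubini') measurable
  also have "\<dots> = (\<integral>\<^sup>+ x. ennreal (min (\<Lambda> s) (X x)) \<partial>Q)"
  proof (rule nn_integral_cong_AE, use exp_rv_pos in eventually_elim)
    case (elim x)
    have "(\<integral>\<^sup>+ y. indicator {0..s} y * ennreal (haz y) * indicator {z. \<Lambda> (snd z) < X (fst z)} (x, y) \<partial>lborel)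
      = (\<integral>\<^sup>+ y. indicator {0..s} y * ennreal (haz y) * indicator {y. \<Lambda> y < X x} y \<partial>lborel)"
      by (intro nn_integral_cong) (auto split: split_indicator)
    then show ?case using cumhaz_before_hit[OF elim, of s] by simp
  qed
  also have "\<dots> = ennreal (1 - exp (- \<Lambda> s))"
    by (rule expectation_min_exp) simp
  finally show ?thesis .
qed

text \<open>There is no sign condition on \<open>s\<close>; for \<open>s \<le> 0\<close> both sides
  are 1. This matters because \<open>s\<close> will be the time left until \<open>t\<close>, which
  is negative for some frozen waiting times.\<close>

lemma hit_survival:
  assumes [measurable]: "(\<lambda>x. hit l (X x) \<omega>) \<in> borel_measurable Q"
  shows "emeasure Q {x \<in> space Q. s < hit l (X x) \<omega>} = ennreal (exp (- \<Lambda> s))"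
proof -
  have "emeasure Q {x \<in> space Q. s < hit l (X x) \<omega>} = emeasure Q {x \<in> space Q. \<Lambda> s < X x}"
    by (rule emeasure_eq_AE) (use AE_hit_le_iff in \<open>eventually_elim, auto simp: not_le[symmetric]\<close>, measurable)
  then show ?thesis by (simp add: exp_rv_gt)
qed

text \<open>Both measures are compared on the half-lines \<open>{..s}\<close>: on the left the event
  becomes \<open>X x \<le> \<Lambda> s\<close> almost surely, on the right the value is
  \<open>density_hazard_atMost\<close>.\<close>

lemma distr_hit:
  assumes [measurable]: "(\<lambda>x. hit l (X x) \<omega>) \<in> borel_measurable Q"
  shows "distr Q borel (\<lambda>x. hit l (X x) \<omega>) = density lborel (\<lambda>s. ennreal (haz s * exp (- \<Lambda> s)))"
    (is "?D = ?R")
proof (rule measure_eqI_generator_eq[where E="range atMost" and \<Omega>=UNIV and A="\<lambda>n. {..real n}"])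
  have D: "emeasure ?D {..s} = ennreal (1 - exp (- \<Lambda> s))" for s
  proof -
    have "emeasure ?D {..s} = emeasure Q {x \<in> space Q. hit l (X x) \<omega> \<le> s}"
      by (subst emeasure_distr) (auto intro!: arg_cong2[where f=emeasure])
    also have "\<dots> = emeasure Q {x \<in> space Q. X x \<le> \<Lambda> s}"
      by (rule emeasure_eq_AE) (use AE_hit_le_iff in \<open>eventually_elim, auto\<close>, measurable)
    finally show ?thesis by (simp add: exp_rv_le)
  qed
  show "Int_stable (range atMost :: real set set)"
    by (auto simp: Int_stable_def)
  fix A :: "real set" assume "A \<in> range atMost"
  then obtain s where [simp]: "A = {..s}" by auto
  have "emeasure ?R {..s} = (\<integral>\<^sup>+ y. indicator {0..s} y * ennreal (haz y * exp (- \<Lambda> y)) \<partial>lborel)"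
    by (subst emeasure_density) (auto intro!: nn_integral_cong split: split_indicator)
  also have "\<dots> = ennreal (1 - exp (- \<Lambda> s))"
    using density_hazard_atMost[of s] cumhaz_nonpos[of s l \<omega>] by (cases "0 \<le> s") auto
  finally show "emeasure ?D A = emeasure ?R A" using D[of s] by simp
next
  fix i :: nat
  show "emeasure ?D {..real i} \<noteq> \<infinity>"
    using finite_measure.emeasure_finite[OF finite_measure.finite_measure_distr] Q
    by (metis (no_types, lifting) assms infinity_ennreal_def prob_space_def)
next
  have "\<exists>n. x \<le> real n" for x by (rule real_arch_simple)
  then show "(\<Union>i. {..real i}) = UNIV" by auto
qed (auto simp: borel_eq_atMost)

end

end

section \<open>Measurability up to null sets\<close>

lemma subalgebra_pair_measure:
  assumes "subalgebra P F"
  shows "subalgebra (U \<Otimes>\<^sub>M P) (U \<Otimes>\<^sub>M F)"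
proof -
  have "space F = space P" "sets F \<subseteq> sets P" using assms by (auto simp: subalgebra_def)
  moreover have "sets (U \<Otimes>\<^sub>M F) \<subseteq> sets (U \<Otimes>\<^sub>M P)"
    unfolding sets_pair_measure \<open>space F = space P\<close>
    by (rule sigma_sets_mono') (use \<open>sets F \<subseteq> sets P\<close> in blast)
  ultimately show ?thesis by (auto simp: subalgebra_def space_pair_measure)
qed

text \<open>The filtration need not contain the null sets. Instead of completing it, a function is
  allowed to differ on a null set from one that is measurable in the strict sense.\<close>

definition AE_measurable :: "'a measure \<Rightarrow> 'a measure \<Rightarrow> ('a \<Rightarrow> real) \<Rightarrow> bool" where
  "AE_measurable P F h \<longleftrightarrow> (\<exists>h'\<in>borel_measurable F. AE x in P. h x = h' x)"

lemma AE_measurableI: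
  "h' \<in> borel_measurable F \<Longrightarrow> AE x in P. h x = h' x \<Longrightarrow> AE_measurable P F h"
  by (auto simp: AE_measurable_def)

lemma AE_measurable_compose:
  assumes "AE_measurable P F h" "f \<in> borel_measurable borel"
  shows "AE_measurable P F (\<lambda>x. f (h x))"
proof -
  obtain h' where [measurable]: "h' \<in> borel_measurable F" and "AE x in P. h x = h' x"
    using assms(1) by (auto simp: AE_measurable_def)
  then show ?thesis
    using assms(2) by (intro AE_measurableI[of "\<lambda>x. f (h' x)"]) auto
qed

lemma AE_measurable_mult:
  assumes "AE_measurable P F f" "AE_measurable P F g"
  shows "AE_measurable P F (\<lambda>x. f x * g x)"
proof -
  obtain f' g' where [measurable]: "f' \<in> borel_measurable F" "g' \<in> borel_measurable F"
    and "AE x in P. f x = f' x" "AE x in P. g x = g' x"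
    using assms by (auto simp: AE_measurable_def)
  then show ?thesis
    by (intro AE_measurableI[of "\<lambda>x. f' x * g' x"]) auto
qed

lemma AE_measurable_prod:
  assumes "finite I" "\<And>i. i \<in> I \<Longrightarrow> AE_measurable P F (f i)"
  shows "AE_measurable P F (\<lambda>x. \<Prod>i\<in>I. f i x)"
  using assms
proof (induction I)
  case empty
  show ?case by (rule AE_measurableI[of "\<lambda>_. 1"]) auto
next
  case (insert i I)
  then show ?case by (simp add: AE_measurable_mult)
qed

text \<open>The function is compared with its conditional expectation given the product algebra on
  rectangles \<open>A \<times> B\<close>: both have \<open>F\<close>-measurable sections, so in both integrals the indicator of
  \<open>B\<close> may be replaced by its conditional expectation given \<open>F\<close>.\<close>

lemma AE_measurable_pair:
  assumes U: "prob_space U" and P: "prob_space P" and sub: "subalgebra P F"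
    and h [measurable]: "h \<in> borel_measurable (U \<Otimes>\<^sub>M P)"
    and ae: "AE u in U. AE_measurable P F (\<lambda>\<omega>. h (u, \<omega>))"
  shows "AE_measurable (U \<Otimes>\<^sub>M P) (U \<Otimes>\<^sub>M F) h"
proof -
  interpret U: prob_space U by fact
  interpret P: prob_space P by fact
  interpret UP: pair_prob_space U P ..
  have subC: "subalgebra (U \<Otimes>\<^sub>M P) (U \<Otimes>\<^sub>M F)"
    by (rule subalgebra_pair_measure[OF sub])
  interpret F: finite_measure_subalgebra P F
    by (standard) (rule sub)
  interpret C: finite_measure_subalgebra "U \<Otimes>\<^sub>M P" "U \<Otimes>\<^sub>M F"
    by (standard) (rule subC)
  \<comment> \<open>The arctangent lies strictly between \<open>- pi / 2\<close> and
    \<open>pi / 2\<close>, and \<open>pi / 2 < 2\<close>; adding 2 gives values between 0 and 4. So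
    \<open>b\<close> is nonnegative and bounded whatever \<open>h\<close> is, and \<open>h\<close>
    can be recovered from it by the tangent.\<close>
  define b where "b x = ennreal (arctan (h x) + 2)" for x
  have b [measurable]: "b \<in> borel_measurable (U \<Otimes>\<^sub>M P)"
    unfolding b_def by measurable
  have pi4: "pi / 2 < 2" using pi_less_4 by simp
  have b_le: "b x \<le> 4" for x
  proof -
    have "arctan (h x) + 2 \<le> 4"
      using arctan_ubound[of "h x"] pi4 by linarith
    then have "ennreal (arctan (h x) + 2) \<le> ennreal 4" by (rule ennreal_leI)
    then show ?thesis unfolding b_def by simp
  qed
  define c where "c = nn_cond_exp (U \<Otimes>\<^sub>M P) (U \<Otimes>\<^sub>M F) b"
  have c_C [measurable]: "c \<in> borel_measurable (U \<Otimes>\<^sub>M F)"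
    unfolding c_def by measurable
  have c [measurable]: "c \<in> borel_measurable (U \<Otimes>\<^sub>M P)"
    unfolding c_def by (rule borel_measurable_nn_cond_exp2)
  have rect: "emeasure (density (U \<Otimes>\<^sub>M P) b) (A \<times> B) = emeasure (density (U \<Otimes>\<^sub>M P) c) (A \<times> B)"
    if A [measurable]: "A \<in> sets U" and B [measurable]: "B \<in> sets P" for A B
  proof -
    define w where "w = nn_cond_exp P F (indicator B)"
    have w_F [measurable]: "w \<in> borel_measurable F" unfolding w_def by measurable
    have w [measurable]: "w \<in> borel_measurable P"
      unfolding w_def by (rule borel_measurable_nn_cond_exp2)
    have sw: "(\<integral>\<^sup>+ \<omega>. f \<omega> * w \<omega> \<partial>P) = (\<integral>\<^sup>+ \<omega>. f \<omega> * indicator B \<omega> \<partial>P)"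
      if "f \<in> borel_measurable F" for f
      unfolding w_def by (rule F.nn_cond_exp_intg) (use that in auto)
    have "emeasure (density (U \<Otimes>\<^sub>M P) b) (A \<times> B)
        = (\<integral>\<^sup>+ x. b x * indicator (A \<times> B) x \<partial>(U \<Otimes>\<^sub>M P))"
      by (subst emeasure_density) auto
    also have "\<dots> = (\<integral>\<^sup>+ u. \<integral>\<^sup>+ \<omega>. b (u, \<omega>) * indicator (A \<times> B) (u, \<omega>) \<partial>P \<partial>U)"
      by (subst P.nn_integral_fst[symmetric]) auto
    also have "\<dots> = (\<integral>\<^sup>+ u. indicator A u * (\<integral>\<^sup>+ \<omega>. b (u, \<omega>) * indicator B \<omega> \<partial>P) \<partial>U)"
      by (intro nn_integral_cong) (auto simp: indicator_times split: split_indicator)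
    also have "\<dots> = (\<integral>\<^sup>+ u. indicator A u * (\<integral>\<^sup>+ \<omega>. b (u, \<omega>) * w \<omega> \<partial>P) \<partial>U)"
    proof (rule nn_integral_cong_AE)
      show "AE u in U. indicator A u * (\<integral>\<^sup>+ \<omega>. b (u, \<omega>) * indicator B \<omega> \<partial>P)
          = indicator A u * (\<integral>\<^sup>+ \<omega>. b (u, \<omega>) * w \<omega> \<partial>P)"
        using ae
      proof eventually_elim
        case (elim u)
        then obtain h' where h': "h' \<in> borel_measurable F" "AE \<omega> in P. h (u, \<omega>) = h' \<omega>"
          by (auto simp: AE_measurable_def)
        have "(\<integral>\<^sup>+ \<omega>. b (u, \<omega>) * f \<omega> \<partial>P) = (\<integral>\<^sup>+ \<omega>. ennreal (arctan (h' \<omega>) + 2) * f \<omega> \<partial>P)" for f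
          by (rule nn_integral_cong_AE) (use h'(2) in \<open>auto simp: b_def\<close>)
        then show ?case
          using sw[of "\<lambda>\<omega>. ennreal (arctan (h' \<omega>) + 2)"] h'(1) by simp
      qed
    qed
    also have "\<dots> = (\<integral>\<^sup>+ u. \<integral>\<^sup>+ \<omega>. (indicator A u * w \<omega>) * b (u, \<omega>) \<partial>P \<partial>U)"
      by (intro nn_integral_cong) (auto simp: mult.commute split: split_indicator)
    also have "\<dots> = (\<integral>\<^sup>+ x. (indicator A (fst x) * w (snd x)) * b x \<partial>(U \<Otimes>\<^sub>M P))"
      by (subst P.nn_integral_fst[symmetric]) auto
    also have "\<dots> = (\<integral>\<^sup>+ x. (indicator A (fst x) * w (snd x)) * c x \<partial>(U \<Otimes>\<^sub>M P))"
      unfolding c_def by (rule C.nn_cond_exp_intg[symmetric]) auto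
    also have "\<dots> = (\<integral>\<^sup>+ u. \<integral>\<^sup>+ \<omega>. (indicator A u * w \<omega>) * c (u, \<omega>) \<partial>P \<partial>U)"
      by (subst P.nn_integral_fst[symmetric]) auto
    also have "\<dots> = (\<integral>\<^sup>+ u. indicator A u * (\<integral>\<^sup>+ \<omega>. c (u, \<omega>) * w \<omega> \<partial>P) \<partial>U)"
      by (intro nn_integral_cong) (auto simp: mult.commute split: split_indicator)
    also have "\<dots> = (\<integral>\<^sup>+ u. indicator A u * (\<integral>\<^sup>+ \<omega>. c (u, \<omega>) * indicator B \<omega> \<partial>P) \<partial>U)"
      by (intro nn_integral_cong arg_cong2[where f="(*)"] sw refl) auto
    also have "\<dots> = (\<integral>\<^sup>+ u. \<integral>\<^sup>+ \<omega>. c (u, \<omega>) * indicator (A \<times> B) (u, \<omega>) \<partial>P \<partial>U)"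
      by (intro nn_integral_cong) (auto simp: indicator_times split: split_indicator)
    also have "\<dots> = (\<integral>\<^sup>+ x. c x * indicator (A \<times> B) x \<partial>(U \<Otimes>\<^sub>M P))"
      by (subst P.nn_integral_fst[symmetric]) auto
    also have "\<dots> = emeasure (density (U \<Otimes>\<^sub>M P) c) (A \<times> B)"
      by (subst emeasure_density) auto
    finally show ?thesis .
  qed
  \<comment> \<open>Rectangles form a generator stable under intersection and both measures are
    finite, so they coincide; their densities then agree almost everywhere, which exhibits
    \<open>c\<close> as the representative sought.\<close>
  have "density (U \<Otimes>\<^sub>M P) b = density (U \<Otimes>\<^sub>M P) c"
  proof (rule measure_eqI_generator_eq[OF Int_stable_pair_measure_generator pair_measure_closed,
        of U P _ _ "\<lambda>_. space U \<times> space P"])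
    fix X assume "X \<in> {a \<times> b |a b. a \<in> sets U \<and> b \<in> sets P}"
    then show "emeasure (density (U \<Otimes>\<^sub>M P) b) X = emeasure (density (U \<Otimes>\<^sub>M P) c) X"
      using rect by auto
  next
    fix i :: nat
    have "emeasure (density (U \<Otimes>\<^sub>M P) b) (space U \<times> space P) \<le> (\<integral>\<^sup>+ x. 4 \<partial>(U \<Otimes>\<^sub>M P))"
      by (subst emeasure_density)
         (auto intro!: nn_integral_mono b_le simp del: nn_integral_const split: split_indicator)
    also have "\<dots> < \<infinity>" by (simp add: UP.emeasure_space_1)
    finally show "emeasure (density (U \<Otimes>\<^sub>M P) b) (space U \<times> space P) \<noteq> \<infinity>" by simp
  qed (auto simp: sets_pair_measure)
  then have "AE x in U \<Otimes>\<^sub>M P. b x = c x"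
    by (subst (asm) UP.density_unique_iff) auto
  then have "AE x in U \<Otimes>\<^sub>M P. h x = tan (enn2real (c x) - 2)"
  proof eventually_elim
    case (elim x)
    have "0 \<le> arctan (h x) + 2" using arctan_lbound[of "h x"] pi4 by linarith
    then have "enn2real (c x) = arctan (h x) + 2" using elim by (metis b_def enn2real_ennreal)
    then show ?case by (simp add: tan_arctan)
  qed
  moreover have "(\<lambda>x. tan (enn2real (c x) - 2)) \<in> borel_measurable (U \<Otimes>\<^sub>M F)"
    unfolding tan_def by measurable
  ultimately show ?thesis by (rule AE_measurableI[rotated])
qed

lemma real_cond_exp_cong_space:
  assumes "prob_space M" "subalgebra M F" and eq: "\<And>x. x \<in> space M \<Longrightarrow> f x = g x"
    and g: "g \<in> borel_measurable M"
  shows "AE x in M. real_cond_exp M F f x = real_cond_exp M F g x"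
proof -
  interpret prob_space M by fact
  interpret finite_measure_subalgebra M F by standard fact
  have "f \<in> borel_measurable M" using g eq by (simp cong: measurable_cong)
  then show ?thesis by (intro real_cond_exp_cong g AE_I2 eq) auto
qed

text \<open>\<open>f\<close> itself need not be integrable here, so its conditional expectation is a generalized one.\<close>

lemma weighted_cond_exp:
  assumes "prob_space M" "subalgebra M F"
    and w: "AE_measurable M F w" "w \<in> borel_measurable M"
    and f [measurable]: "f \<in> borel_measurable M" and g [measurable]: "g \<in> borel_measurable M"
    and int: "integrable M (\<lambda>x. w x * f x)" and gf: "AE x in M. g x = real_cond_exp M F f x"
  shows "integrable M (\<lambda>x. w x * g x)"
    and "(\<integral>x. \<bar>w x * g x\<bar> \<partial>M) \<le> (\<integral>x. \<bar>w x * f x\<bar> \<partial>M)"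
    and "\<And>B. B \<in> sets F \<Longrightarrow> (\<integral>x. indicator B x * (w x * g x) \<partial>M) = (\<integral>x. indicator B x * (w x * f x) \<partial>M)"
proof -
  interpret prob_space M by fact
  interpret finite_measure_subalgebra M F by standard fact
  note w(2) [measurable]
  obtain w' where w'F [measurable]: "w' \<in> borel_measurable F" and w': "AE x in M. w x = w' x"
    using w(1) by (auto simp: AE_measurable_def)
  have [measurable]: "w' \<in> borel_measurable M" by (rule measurable_from_subalg[OF subalg w'F])
  have int': "integrable M (\<lambda>x. w' x * f x)"
    using int by (rule integrable_cong_AE_imp) (use w' in auto)
  define c where "c = real_cond_exp M F f"
  have cF [measurable]: "c \<in> borel_measurable F" and [measurable]: "c \<in> borel_measurable M"
    unfolding c_def by (rule borel_measurable_cond_exp borel_measurable_cond_exp2)+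
  \<comment> \<open>Bounded test functions \<open>s\<close> serve all three claims: the constant 1
    for integrability, a sign for the norm bound, and an indicator for the integrals over events.
    Only the weighted product has to be integrable, not \<open>f\<close>.\<close>
  have c: "integrable M (\<lambda>x. s x * (w' x * c x))"
      "(\<integral>x. s x * (w' x * c x) \<partial>M) = (\<integral>x. s x * (w' x * f x) \<partial>M)"
    if s [measurable]: "s \<in> borel_measurable F" and s1: "\<And>x. \<bar>s x\<bar> \<le> 1" for s
  proof -
    have [measurable]: "s \<in> borel_measurable M" by (rule measurable_from_subalg[OF subalg s])
    have "integrable M (\<lambda>x. (s x * w' x) * f x)"
      by (rule Bochner_Integration.integrable_bound[OF int'])
         (auto simp: abs_mult mult.assoc intro!: mult_left_le_one_le s1)
    from real_cond_exp_intg[OF this] show "integrable M (\<lambda>x. s x * (w' x * c x))"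
      "(\<integral>x. s x * (w' x * c x) \<partial>M) = (\<integral>x. s x * (w' x * f x) \<partial>M)"
      by (auto simp: c_def mult.assoc)
  qed
  have AE_c: "AE x in M. w x * g x = w' x * c x" using w' gf by (auto simp: c_def)
  show "integrable M (\<lambda>x. w x * g x)"
    using c(1)[of "\<lambda>_. 1"] by (rule integrable_cong_AE_imp) (use AE_c in auto)
  \<comment> \<open>The sign of \<open>w' x * c x\<close> is itself \<open>F\<close>-measurable, so
    the absolute value can be taken through the conditional expectation; this is its contraction
    property with the weight left inside.\<close>
  have "(\<integral>x. \<bar>w x * g x\<bar> \<partial>M) = (\<integral>x. sgn (w' x * c x) * (w' x * c x) \<partial>M)"
    by (rule integral_cong_AE) (use AE_c in \<open>auto simp: abs_sgn mult.commute\<close>)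
  also have "\<dots> = (\<integral>x. sgn (w' x * c x) * (w' x * f x) \<partial>M)"
    by (rule c(2)) (auto simp: abs_sgn_eq)
  also have "\<dots> \<le> (\<integral>x. \<bar>w' x * f x\<bar> \<partial>M)"
  proof (rule integral_mono_AE)
    show "integrable M (\<lambda>x. sgn (w' x * c x) * (w' x * f x))"
      by (rule Bochner_Integration.integrable_bound[OF int'])
         (auto simp: abs_mult sgn_if)
    show "AE x in M. sgn (w' x * c x) * (w' x * f x) \<le> \<bar>w' x * f x\<bar>"
      by (intro AE_I2) (auto simp: sgn_if)
  qed (use int' in auto)
  also have "\<dots> = (\<integral>x. \<bar>w x * f x\<bar> \<partial>M)"
    by (rule integral_cong_AE) (use w' in auto)
  finally show "(\<integral>x. \<bar>w x * g x\<bar> \<partial>M) \<le> (\<integral>x. \<bar>w x * f x\<bar> \<partial>M)" .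
  fix B assume B: "B \<in> sets F"
  then have [measurable]: "B \<in> sets M" using subalg by (auto simp: subalgebra_def)
  have "(\<integral>x. indicator B x * (w x * g x) \<partial>M) = (\<integral>x. indicator B x * (w' x * c x) \<partial>M)"
    by (rule integral_cong_AE) (use AE_c in auto)
  also have "\<dots> = (\<integral>x. indicator B x * (w' x * f x) \<partial>M)"
    by (rule c(2)) (use B in \<open>auto split: split_indicator\<close>)
  also have "\<dots> = (\<integral>x. indicator B x * (w x * f x) \<partial>M)"
    by (rule integral_cong_AE) (use w' in auto)
  finally show "(\<integral>x. indicator B x * (w x * g x) \<partial>M) = (\<integral>x. indicator B x * (w x * f x) \<partial>M)" .
qed

section \<open>The conditional law of the waiting times\<close>

text \<open>The two measures agree on boxes, because both the density and the indicator of a box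
  factor over the coordinates.\<close>

lemma PiM_density:
  fixes M :: "'i \<Rightarrow> 'a measure" and f :: "'i \<Rightarrow> 'a \<Rightarrow> ennreal"
  assumes "product_sigma_finite M" "product_sigma_finite (\<lambda>i. density (M i) (f i))"
    and I: "finite I" and f [measurable]: "\<And>i. f i \<in> borel_measurable (M i)"
  shows "PiM I (\<lambda>i. density (M i) (f i)) = density (PiM I M) (\<lambda>x. \<Prod>i\<in>I. f i (x i))"
proof -
  interpret M: product_sigma_finite M by fact
  interpret D: product_sigma_finite "\<lambda>i. density (M i) (f i)" by fact
  have prod_meas: "(\<lambda>x. \<Prod>i\<in>I. f i (x i)) \<in> borel_measurable (PiM I M)"
    by (intro borel_measurable_prod_ennreal) measurable
  show ?thesis
  proof (rule D.PiM_eqI[symmetric, OF I])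
    show "sets (density (PiM I M) (\<lambda>x. \<Prod>i\<in>I. f i (x i))) = sets (PiM I (\<lambda>i. density (M i) (f i)))"
      by (simp cong: sets_PiM_cong)
    fix A assume A: "\<And>i. i \<in> I \<Longrightarrow> A i \<in> sets (density (M i) (f i))"
    have "emeasure (density (PiM I M) (\<lambda>x. \<Prod>i\<in>I. f i (x i))) (Pi\<^sub>E I A)
        = (\<integral>\<^sup>+ x. (\<Prod>i\<in>I. f i (x i)) * indicator (Pi\<^sub>E I A) x \<partial>PiM I M)"
      by (rule emeasure_density[OF prod_meas]) (use A I in \<open>auto intro!: sets_PiM_I_finite\<close>)
    also have "\<dots> = (\<integral>\<^sup>+ x. (\<Prod>i\<in>I. f i (x i) * indicator (A i) (x i)) \<partial>PiM I M)"
    proof (rule nn_integral_cong)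
      fix x assume x: "x \<in> space (PiM I M)"
      show "(\<Prod>i\<in>I. f i (x i)) * indicator (Pi\<^sub>E I A) x = (\<Prod>i\<in>I. f i (x i) * indicator (A i) (x i))"
      proof (cases "x \<in> Pi\<^sub>E I A")
        case True
        then show ?thesis by (auto intro!: prod.cong simp: PiE_iff)
      next
        case False
        then obtain i where "i \<in> I" "x i \<notin> A i" using x by (auto simp: space_PiM PiE_iff)
        then show ?thesis using False I by (auto simp: prod_zero_iff intro!: prod_zero[symmetric] bexI[of _ i])
      qed
    qed
    also have "\<dots> = (\<Prod>i\<in>I. \<integral>\<^sup>+ y. f i y * indicator (A i) y \<partial>M i)"
      by (rule M.product_nn_integral_prod[OF I]) (use A in auto)
    also have "\<dots> = (\<Prod>i\<in>I. emeasure (density (M i) (f i)) (A i))"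
      by (intro prod.cong refl emeasure_density[symmetric]) (use A in auto)
    finally show "emeasure (density (PiM I M) (\<lambda>x. \<Prod>i\<in>I. f i (x i))) (Pi\<^sub>E I A)
        = (\<Prod>i\<in>I. emeasure (density (M i) (f i)) (A i))" .
  qed
qed

text \<open>Any probability measure equivalent to Lebesgue measure on the half-line would do as reference
  measure.\<close>

definition exp_law :: "real measure" where
  "exp_law = density lborel (\<lambda>x. ennreal (exponential_density 1 x))"

lemma sets_exp_law [measurable_cong, simp]: "sets exp_law = sets borel"
  by (simp add: exp_law_def)

lemma space_exp_law [simp]: "space exp_law = UNIV"
  by (simp add: exp_law_def)

lemma prob_space_exp_law: "prob_space exp_law"
  unfolding exp_law_def by (rule prob_space_exponential_density) simp

text \<open>The density is strictly positive on the closed half-line and zero elsewhere, so on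
  nonnegative times the reference law and Lebesgue measure have the same null sets.\<close>

lemma AE_exp_law: "(AE s in exp_law. Q s) \<longleftrightarrow> (AE s in lborel. 0 \<le> s \<longrightarrow> Q s)"
  unfolding exp_law_def by (subst AE_density) (auto simp: exponential_density_def)

declare One_nat_def [simp del]

locale default_times =
  fixes P :: "'a measure" and Ph :: "'b measure" and F :: "real \<Rightarrow> 'a measure" and N :: nat
    and E :: "nat \<Rightarrow> 'b \<Rightarrow> real" and lam :: "nat \<Rightarrow> real \<Rightarrow> 'a \<Rightarrow> real"
  assumes P_prob: "prob_space P" and Ph_prob: "prob_space Ph"
    and F_space: "\<And>s. 0 \<le> s \<Longrightarrow> space (F s) = space P"
    and F_sub: "\<And>s. 0 \<le> s \<Longrightarrow> sets (F s) \<subseteq> sets P"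
    and F_mono: "\<And>s r. 0 \<le> s \<Longrightarrow> s \<le> r \<Longrightarrow> sets (F s) \<subseteq> sets (F r)"
    and E_indep: "prob_space.indep_vars Ph (\<lambda>_. borel) E {1..N}"
    and E_exp: "\<And>n. n \<in> {1..N} \<Longrightarrow> distributed Ph lborel (E n) (exponential_density 1)"
    and lam_meas: "\<And>n. n \<in> {1..N} \<Longrightarrow>
        (\<lambda>(s, \<omega>). lam n s \<omega>) \<in> borel_measurable (restrict_space borel {0..} \<Otimes>\<^sub>M P)"
    and lam_adapted: "\<And>n s. n \<in> {1..N} \<Longrightarrow> 0 \<le> s \<Longrightarrow> lam n s \<in> borel_measurable (F s)"
    and lam_nonneg: "\<And>n s \<omega>. n \<in> {1..N} \<Longrightarrow> 0 \<le> s \<Longrightarrow> \<omega> \<in> space P \<Longrightarrow> 0 \<le> lam n s \<omega>"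
    and lam_fin: "\<And>n. n \<in> {1..N} \<Longrightarrow> AE \<omega> in P. \<forall>r\<ge>0. cumhaz (lam n) r \<omega> < \<infinity>"
    and lam_inf: "\<And>n. n \<in> {1..N} \<Longrightarrow>
        AE \<omega> in P. (\<integral>\<^sup>+ s. indicator {0..} s * ennreal (lam n s \<omega>) \<partial>lborel) = \<infinity>"
begin

sublocale P: prob_space P by (rule P_prob)
sublocale Ph: prob_space Ph by (rule Ph_prob)
sublocale M: pair_prob_space P Ph ..

lemma F_subalgebra: "0 \<le> s \<Longrightarrow> subalgebra P (F s)"
  using F_space F_sub by (simp add: subalgebra_def)

lemma lam0_measurable_pair:
  assumes n: "n \<in> {1..N}"
  shows "(\<lambda>x. if 0 \<le> fst x then lam n (fst x) (snd x) else 0) \<in> borel_measurable (borel \<Otimes>\<^sub>M P)"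
proof -
  \<comment> \<open>Moving negative times to 0 gives a total map into the half-line on which
    \<open>lam\<close> is known to be measurable; the later case distinction hides the values so
    introduced.\<close>
  have [measurable]: "(\<lambda>x. max 0 (fst x)) \<in> borel \<Otimes>\<^sub>M P \<rightarrow>\<^sub>M restrict_space borel {0::real..}"
    by (rule measurable_restrict_space2) auto
  have "(\<lambda>x. (case (max 0 (fst x), snd x) of (s, \<omega>) \<Rightarrow> lam n s \<omega>)) \<in> borel_measurable (borel \<Otimes>\<^sub>M P)"
    by (rule measurable_compose[OF _ lam_meas[OF n]]) measurable
  then have [measurable]: "(\<lambda>x. lam n (max 0 (fst x)) (snd x)) \<in> borel_measurable (borel \<Otimes>\<^sub>M P)"
    by simp
  have "(\<lambda>x. if 0 \<le> fst x then lam n (fst x) (snd x) else 0)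
     = (\<lambda>x. if 0 \<le> fst x then lam n (max 0 (fst x)) (snd x) else 0)" by auto
  also have "\<dots> \<in> borel_measurable (borel \<Otimes>\<^sub>M P)" by measurable
  finally show ?thesis .
qed

lemma lam0_measurable:
  assumes n: "n \<in> {1..N}" and fg: "f \<in> borel_measurable Q" "g \<in> Q \<rightarrow>\<^sub>M P"
  shows "(\<lambda>x. if 0 \<le> f x then lam n (f x) (g x) else 0) \<in> borel_measurable Q"
  using measurable_compose[OF measurable_Pair[OF fg] lam0_measurable_pair[OF n]]
  by (simp only: fst_conv snd_conv)

lemma cumhaz_measurable_pair:
  assumes n: "n \<in> {1..N}"
  shows "(\<lambda>x. cumhaz (lam n) (fst x) (snd x)) \<in> borel_measurable (borel \<Otimes>\<^sub>M P)"
proof -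
  have [measurable]: "(\<lambda>y. if 0 \<le> snd y then lam n (snd y) (snd (fst y)) else 0)
      \<in> borel_measurable ((borel \<Otimes>\<^sub>M P) \<Otimes>\<^sub>M lborel)"
    by (rule lam0_measurable[OF n]) auto
  have eq: "cumhaz (lam n) (fst x) (snd x) = (\<integral>\<^sup>+ s. (if 0 \<le> s \<and> s \<le> fst x
      then ennreal (if 0 \<le> s then lam n s (snd x) else 0) else 0) \<partial>lborel)" for x
    unfolding cumhaz_def by (intro nn_integral_cong) (auto split: split_indicator)
  show ?thesis
    unfolding eq by (intro lborel.borel_measurable_nn_integral) (simp add: split_beta, measurable)
qed

lemma cumhaz_measurable:
  assumes "n \<in> {1..N}" "f \<in> borel_measurable Q" "g \<in> Q \<rightarrow>\<^sub>M P"
  shows "(\<lambda>x. cumhaz (lam n) (f x) (g x)) \<in> borel_measurable Q"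
  using measurable_compose[OF _ cumhaz_measurable_pair[OF assms(1)], of "\<lambda>x. (f x, g x)" Q] assms(2,3)
  by simp

lemma hit_measurable:
  assumes n: "n \<in> {1..N}" and [measurable]: "f \<in> borel_measurable Q" "g \<in> Q \<rightarrow>\<^sub>M P"
  shows "(\<lambda>x. hit (lam n) (f x) (g x)) \<in> borel_measurable Q"
proof -
  have [measurable]: "(\<lambda>x. cumhaz (lam n) r (g x)) \<in> borel_measurable Q" for r
    by (rule cumhaz_measurable[OF n]) auto
  show ?thesis
    unfolding borel_measurable_iff_less hit_less_iff by measurable
qed

lemma E_measurable: "n \<in> {1..N} \<Longrightarrow> E n \<in> borel_measurable Ph"
  using distributed_measurable[OF E_exp[of n]] by simp

lemma ttau_measurable:
  assumes n: "n \<in> {1..N}" and f: "f \<in> Q \<rightarrow>\<^sub>M P \<Otimes>\<^sub>M Ph"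
  shows "(\<lambda>x. ttau lam E n (f x)) \<in> borel_measurable Q"
  unfolding ttau_eq_hit
  using f E_measurable[OF n]
  by (intro hit_measurable[OF n] measurable_compose[of "\<lambda>x. snd (f x)" Q Ph "E n" borel]) auto

lemma ttau_nonneg: "0 \<le> ttau lam E n x"
  by (simp add: ttau_eq_hit hit_nonneg)

lemma AE_hazard_path: "AE \<omega> in P. \<omega> \<in> space P \<and> (\<forall>n\<in>{1..N}. hazard_path (lam n) \<omega>)"
proof -
  have "AE \<omega> in P. \<forall>n\<in>{1..N}. hazard_path (lam n) \<omega>"
  proof (rule AE_finite_allI)
    fix n assume n: "n \<in> {1..N}"
    show "AE \<omega> in P. hazard_path (lam n) \<omega>"
      using lam_fin[OF n] lam_inf[OF n] AE_space
    proof eventually_elim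
      case (elim \<omega>)
      show ?case
      proof
        show "(\<lambda>s. if 0 \<le> s then lam n s \<omega> else 0) \<in> borel_measurable borel"
          by (rule lam0_measurable[OF n]) (use elim(3) in auto)
      qed (use elim in auto)
    qed
  qed simp
  then show ?thesis using AE_space by eventually_elim simp
qed

text \<open>The density is taken relative to the reference measure, hence the factor \<open>exp s\<close>.\<close>

definition dens :: "nat \<Rightarrow> real \<Rightarrow> 'a \<Rightarrow> real" where
  "dens n s \<omega> = (if 0 \<le> s then lam n s \<omega> else 0) * exp (- enn2real (cumhaz (lam n) s \<omega>)) * exp s"

lemma dens_measurable:
  assumes n: "n \<in> {1..N}" and [measurable]: "f \<in> borel_measurable Q" "g \<in> Q \<rightarrow>\<^sub>M P"
  shows "(\<lambda>x. dens n (f x) (g x)) \<in> borel_measurable Q"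
proof -
  have [measurable]: "(\<lambda>x. cumhaz (lam n) (f x) (g x)) \<in> borel_measurable Q"
    by (rule cumhaz_measurable[OF n]) auto
  show ?thesis
    unfolding dens_def by (intro borel_measurable_times lam0_measurable[OF n]) measurable
qed

lemma dens_nonneg: "n \<in> {1..N} \<Longrightarrow> \<omega> \<in> space P \<Longrightarrow> 0 \<le> dens n s \<omega>"
  using lam_nonneg by (simp add: dens_def)

lemma distr_ttau:
  assumes n: "n \<in> {1..N}" and \<omega>: "\<omega> \<in> space P" and "hazard_path (lam n) \<omega>"
  shows "distr Ph borel (\<lambda>\<omega>h. ttau lam E n (\<omega>, \<omega>h)) = density exp_law (\<lambda>s. ennreal (dens n s \<omega>))"
proof -
  interpret hazard_path "lam n" \<omega> by fact
  have [measurable]: "(\<lambda>s. dens n s \<omega>) \<in> borel_measurable borel"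
    by (rule dens_measurable[OF n]) (use \<omega> in auto)
  have "distr Ph borel (\<lambda>\<omega>h. ttau lam E n (\<omega>, \<omega>h)) = density lborel (\<lambda>s. ennreal (haz s * exp (- \<Lambda> s)))"
    unfolding ttau_eq_hit fst_conv snd_conv
    by (rule distr_hit[OF Ph_prob E_exp[OF n]]) (use \<omega> E_measurable[OF n] in \<open>auto intro!: hit_measurable n\<close>)
  also have "\<dots> = density lborel (\<lambda>s. ennreal (exponential_density 1 s) * ennreal (dens n s \<omega>))"
    by (intro density_cong AE_I2)
       (auto simp: dens_def exponential_density_def exp_minus field_simps simp flip: ennreal_mult')
  also have "\<dots> = density exp_law (\<lambda>s. ennreal (dens n s \<omega>))"
    unfolding exp_law_def by (subst density_density_eq) auto
  finally show ?thesis .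
qed

section \<open>Joint conditional law of the waiting times\<close>

definition incr :: "nat set \<Rightarrow> 'a \<times> 'b \<Rightarrow> nat \<Rightarrow> real" where
  "incr I x = (\<lambda>j\<in>I. ttau lam E j x)"

lemma incr_measurable:
  assumes "I \<subseteq> {1..N}" and f [measurable]: "f \<in> Q \<rightarrow>\<^sub>M P \<Otimes>\<^sub>M Ph"
  shows "(\<lambda>x. incr I (f x)) \<in> Q \<rightarrow>\<^sub>M PiM I (\<lambda>_. borel)"
  unfolding incr_def using assms by (intro measurable_restrict ttau_measurable) auto

text \<open>By \<open>distr_incr\<close> this is the conditional density, given the scenario, of the
  first \<open>k\<close> waiting times relative to the product reference law
  \<open>U k\<close>.\<close>

definition dens_prod :: "nat \<Rightarrow> (nat \<Rightarrow> real) \<Rightarrow> 'a \<Rightarrow> real" where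
  "dens_prod k v \<omega> = (\<Prod>j=1..k. dens j (v j) \<omega>)"

abbreviation U :: "nat \<Rightarrow> (nat \<Rightarrow> real) measure" where
  "U k \<equiv> PiM {1..k} (\<lambda>_. exp_law)"

lemma prob_space_U: "prob_space (U k)"
  by (intro prob_space_PiM prob_space_exp_law)

lemma sets_U [measurable_cong]: "sets (U k) = sets (PiM {1..k} (\<lambda>_. borel))"
  by (intro sets_PiM_cong) auto

lemma dens_prod_nonneg: "k \<le> N \<Longrightarrow> \<omega> \<in> space P \<Longrightarrow> 0 \<le> dens_prod k v \<omega>"
  unfolding dens_prod_def by (intro prod_nonneg ballI dens_nonneg) auto

lemma dens_prod_measurable:
  assumes "k \<le> N" and [measurable]: "f \<in> Q \<rightarrow>\<^sub>M U k" "g \<in> Q \<rightarrow>\<^sub>M P"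
  shows "(\<lambda>x. dens_prod k (f x) (g x)) \<in> borel_measurable Q"
proof -
  have "(\<lambda>x. f x j) \<in> borel_measurable Q" if "j \<in> {1..k}" for j
    using measurable_compose[OF assms(2) measurable_component_singleton[OF that]]
    by (simp cong: measurable_cong_sets)
  then show ?thesis
    unfolding dens_prod_def using assms by (intro borel_measurable_prod dens_measurable) auto
qed

text \<open>With the scenario frozen, each waiting time is a measurable function of its own
  threshold alone, so it inherits independence from the thresholds.\<close>

lemma indep_ttau:
  assumes "\<omega> \<in> space P"
  shows "Ph.indep_vars (\<lambda>_. borel) (\<lambda>j \<omega>h. ttau lam E j (\<omega>, \<omega>h)) {1..N}"
  unfolding ttau_eq_hit fst_conv snd_conv
  by (rule Ph.indep_vars_compose2[OF E_indep, of "\<lambda>j e. hit (lam j) e \<omega>"])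
     (use assms in \<open>auto intro!: hit_measurable\<close>)

lemma distr_incr:
  assumes \<omega>: "\<omega> \<in> space P" and haz: "\<forall>n\<in>{1..N}. hazard_path (lam n) \<omega>" and k: "k \<le> N"
  shows "distr Ph (PiM {1..k} (\<lambda>_. borel)) (\<lambda>\<omega>h. incr {1..k} (\<omega>, \<omega>h))
    = density (U k) (\<lambda>v. ennreal (dens_prod k v \<omega>))"
proof -
  \<comment> \<open>The factor 1 outside \<open>{1..k}\<close> makes every coordinate measure a
    probability, since sigma-finiteness is demanded at all indices.\<close>
  define f where "f j s = (if j \<in> {1..k} then ennreal (dens j s \<omega>) else 1)" for j s
  have f [measurable]: "f j \<in> borel_measurable exp_law" for j
    unfolding f_def using dens_measurable[of j "\<lambda>s. s" borel "\<lambda>_. \<omega>"] k \<omega>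
    by (cases "j \<in> {1..k}") (auto cong: measurable_cong_sets)
  have law: "distr Ph borel (\<lambda>\<omega>h. ttau lam E j (\<omega>, \<omega>h)) = density exp_law (f j)" if "j \<in> {1..k}" for j
    using distr_ttau[of j \<omega>] that k \<omega> haz by (simp add: f_def[abs_def])
  have X [measurable]: "(\<lambda>\<omega>h. ttau lam E j (\<omega>, \<omega>h)) \<in> borel_measurable Ph" if "j \<in> {1..k}" for j
    using that k \<omega> by (intro ttau_measurable) auto
  have prob_f: "prob_space (density exp_law (f j))" for j
  proof (cases "j \<in> {1..k}")
    case True
    then show ?thesis using Ph.prob_space_distr[OF X[OF True]] law by simp
  next
    case False
    then have "f j = (\<lambda>_. 1)" by (auto simp: f_def)
    then show ?thesis using prob_space_exp_law by (simp add: density_1)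
  qed
  have psf: "product_sigma_finite (\<lambda>_::nat. exp_law)" "product_sigma_finite (\<lambda>j. density exp_law (f j))"
    using prob_f prob_space_exp_law
    by (auto simp: product_sigma_finite_def intro: prob_space_imp_sigma_finite)
  have "distr Ph (PiM {1..k} (\<lambda>_. borel)) (\<lambda>\<omega>h. incr {1..k} (\<omega>, \<omega>h)) = PiM {1..k} (\<lambda>j. density exp_law (f j))"
  \<comment> \<open>Characterizing independence by a product law needs a nonempty index set. For
    \<open>k = 0\<close> both sides are probability measures on a one-point space.\<close>
  proof (cases "k = 0")
    case True
    interpret D: prob_space "distr Ph (PiM {1..k} (\<lambda>_. borel)) (\<lambda>\<omega>h. incr {1..k} (\<omega>, \<omega>h))"
      by (rule Ph.prob_space_distr) (use k \<omega> in \<open>auto intro!: incr_measurable\<close>)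
    show ?thesis
    proof (rule product_sigma_finite.PiM_eqI[OF psf(2)])
      fix A :: "nat \<Rightarrow> real set"
      show "D.events = sets (PiM {1..k} (\<lambda>j. density exp_law (f j)))" by (simp cong: sets_PiM_cong)
      show "emeasure (distr Ph (PiM {1..k} (\<lambda>_. borel)) (\<lambda>\<omega>h. incr {1..k} (\<omega>, \<omega>h))) (Pi\<^sub>E {1..k} A)
          = (\<Prod>i\<in>{1..k}. emeasure (density exp_law (f i)) (A i))"
        using D.emeasure_space_1 True by (simp add: space_PiM)
    qed simp
  next
    case False
    have "distr Ph (PiM {1..k} (\<lambda>_. borel)) (\<lambda>\<omega>h. incr {1..k} (\<omega>, \<omega>h))
        = PiM {1..k} (\<lambda>j. distr Ph borel (\<lambda>\<omega>h. ttau lam E j (\<omega>, \<omega>h)))"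
      unfolding incr_def
      by (subst Ph.indep_vars_iff_distr_eq_PiM'[symmetric])
         (use False X k in \<open>auto intro!: Ph.indep_vars_subset[OF indep_ttau[OF \<omega>]]\<close>)
    also have "\<dots> = PiM {1..k} (\<lambda>j. density exp_law (f j))"
      by (rule PiM_cong[OF refl law])
    finally show ?thesis .
  qed
  also have "\<dots> = density (U k) (\<lambda>v. \<Prod>j=1..k. f j (v j))"
    by (rule PiM_density[OF psf]) auto
  also have "\<dots> = density (U k) (\<lambda>v. ennreal (dens_prod k v \<omega>))"
  proof -
    have "(\<Prod>j=1..k. f j (v j)) = ennreal (dens_prod k v \<omega>)" for v
    proof -
      have "(\<Prod>j=1..k. f j (v j)) = (\<Prod>j=1..k. ennreal (dens j (v j) \<omega>))"
        by (intro prod.cong) (auto simp: f_def)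
      also have "\<dots> = ennreal (dens_prod k v \<omega>)"
        unfolding dens_prod_def by (rule prod_ennreal) (use k \<omega> in \<open>auto intro!: dens_nonneg\<close>)
      finally show ?thesis .
    qed
    then show ?thesis by simp
  qed
  finally show ?thesis .
qed

text \<open>Given the scenario, the first \<open>k\<close> waiting times are independent of the
  later ones. Only the first block is replaced by its density; the later block stays an integral
  over \<open>Ph\<close>, the form in which it appears in the formula to be proved.\<close>

lemma nn_integral_incr_split:
  assumes \<omega> [measurable]: "\<omega> \<in> space P" and haz: "\<forall>n\<in>{1..N}. hazard_path (lam n) \<omega>" and k: "k \<le> N"
    and G [measurable]: "G \<in> borel_measurable (PiM {1..k} (\<lambda>_. borel) \<Otimes>\<^sub>M PiM {k+1..N} (\<lambda>_. borel))"
  shows "(\<integral>\<^sup>+ \<omega>h. G (incr {1..k} (\<omega>, \<omega>h), incr {k+1..N} (\<omega>, \<omega>h)) \<partial>Ph)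
    = (\<integral>\<^sup>+ v. ennreal (dens_prod k v \<omega>) * (\<integral>\<^sup>+ \<omega>h. G (v, incr {k+1..N} (\<omega>, \<omega>h)) \<partial>Ph) \<partial>U k)"
proof -
  let ?A = "PiM {1..k} (\<lambda>_. borel) :: (nat \<Rightarrow> real) measure"
  let ?B = "PiM {k+1..N} (\<lambda>_. borel) :: (nat \<Rightarrow> real) measure"
  let ?X = "\<lambda>\<omega>h. incr {1..k} (\<omega>, \<omega>h)" and ?Y = "\<lambda>\<omega>h. incr {k+1..N} (\<omega>, \<omega>h)"
  have "Ph.indep_var ?A ?X ?B ?Y"
    unfolding incr_def by (rule Ph.indep_var_restrict[OF indep_ttau[OF \<omega>]]) (use k in auto)
  then have X [measurable]: "?X \<in> Ph \<rightarrow>\<^sub>M ?A" and Y [measurable]: "?Y \<in> Ph \<rightarrow>\<^sub>M ?B"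
    and D: "distr Ph (?A \<Otimes>\<^sub>M ?B) (\<lambda>\<omega>h. (?X \<omega>h, ?Y \<omega>h)) = distr Ph ?A ?X \<Otimes>\<^sub>M distr Ph ?B ?Y"
    by (auto simp: Ph.indep_var_distribution_eq)
  interpret Y: prob_space "distr Ph ?B ?Y" by (rule Ph.prob_space_distr) simp
  have [measurable]: "(\<lambda>v. ennreal (dens_prod k v \<omega>)) \<in> borel_measurable (U k)"
    by (intro measurable_compose[OF _ measurable_ennreal] dens_prod_measurable k) auto
  have "(\<integral>\<^sup>+ \<omega>h. G (?X \<omega>h, ?Y \<omega>h) \<partial>Ph) = (\<integral>\<^sup>+ z. G z \<partial>(distr Ph ?A ?X \<Otimes>\<^sub>M distr Ph ?B ?Y))"
    unfolding D[symmetric] by (subst nn_integral_distr) auto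
  also have "\<dots> = (\<integral>\<^sup>+ v. \<integral>\<^sup>+ w. G (v, w) \<partial>distr Ph ?B ?Y \<partial>distr Ph ?A ?X)"
    by (subst Y.nn_integral_fst[symmetric]) auto
  also have "\<dots> = (\<integral>\<^sup>+ v. \<integral>\<^sup>+ \<omega>h. G (v, ?Y \<omega>h) \<partial>Ph \<partial>distr Ph ?A ?X)"
    by (intro nn_integral_cong nn_integral_distr) auto
  also have "\<dots> = (\<integral>\<^sup>+ v. ennreal (dens_prod k v \<omega>) * (\<integral>\<^sup>+ \<omega>h. G (v, ?Y \<omega>h) \<partial>Ph) \<partial>U k)"
    unfolding distr_incr[OF \<omega> haz k] by (subst nn_integral_density) auto
  finally show ?thesis .
qed

definition V :: "nat \<Rightarrow> ((nat \<Rightarrow> real) \<times> 'a) measure" where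
  "V k = U k \<Otimes>\<^sub>M P"

sublocale U: prob_space "U k" for k by (rule prob_space_U)
sublocale UP: pair_prob_space "U k" P for k ..

lemma prob_space_V: "prob_space (V k)"
  unfolding V_def by (rule UP.prob_space_axioms)

sublocale V: prob_space "V k" for k by (rule prob_space_V)
sublocale VPh: pair_prob_space "V k" Ph for k ..

lemma sets_V [measurable_cong]: "sets (V k) = sets (PiM {1..k} (\<lambda>_. borel) \<Otimes>\<^sub>M P)"
  unfolding V_def by (intro sets_pair_measure_cong sets_U) simp

text \<open>The increments up to \<open>k\<close> may be frozen at values drawn independently of everything else,
  at the price of the density of their conditional law.\<close>

lemma distr_incr_split:
  assumes k: "k \<le> N"
  shows "distr (P \<Otimes>\<^sub>M Ph) (V k \<Otimes>\<^sub>M PiM {k+1..N} (\<lambda>_. borel))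
      (\<lambda>x. ((incr {1..k} x, fst x), incr {k+1..N} x))
    = distr (density (V k \<Otimes>\<^sub>M Ph) (\<lambda>z. ennreal (dens_prod k (fst (fst z)) (snd (fst z)))))
      (V k \<Otimes>\<^sub>M PiM {k+1..N} (\<lambda>_. borel)) (\<lambda>z. (fst z, incr {k+1..N} (snd (fst z), snd z)))"
    (is "distr ?M ?R ?f = distr (density ?W ?d) ?R ?g")
proof (rule measure_eqI)
  have i1 [measurable]: "incr {1..k} \<in> P \<Otimes>\<^sub>M Ph \<rightarrow>\<^sub>M PiM {1..k} (\<lambda>_. borel)"
    using incr_measurable[of "{1..k}" "\<lambda>x. x"] k by auto
  have i2 [measurable]: "incr {k+1..N} \<in> P \<Otimes>\<^sub>M Ph \<rightarrow>\<^sub>M PiM {k+1..N} (\<lambda>_. borel)"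
    using incr_measurable[of "{k+1..N}" "\<lambda>x. x"] by auto
  have [measurable]: "(\<lambda>y. dens_prod k (fst y) (snd y)) \<in> borel_measurable (V k)"
    by (rule dens_prod_measurable[OF k]) measurable
  fix A assume "A \<in> sets (distr ?M ?R ?f)"
  then have A [measurable]: "A \<in> sets ?R" by simp
  have "emeasure (distr ?M ?R ?f) A = (\<integral>\<^sup>+ x. indicator A (?f x) \<partial>?M)"
  proof -
    have "emeasure (distr ?M ?R ?f) A = (\<integral>\<^sup>+ z. indicator A z \<partial>distr ?M ?R ?f)"
      by (rule nn_integral_indicator[symmetric]) simp
    then show ?thesis by (subst (asm) nn_integral_distr) measurable
  qed
  also have "\<dots> = (\<integral>\<^sup>+ \<omega>. \<integral>\<^sup>+ \<omega>h. indicator A (?f (\<omega>, \<omega>h)) \<partial>Ph \<partial>P)"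
    by (subst Ph.nn_integral_fst) auto
  also have "\<dots> = (\<integral>\<^sup>+ \<omega>. \<integral>\<^sup>+ v. ennreal (dens_prod k v \<omega>) *
      (\<integral>\<^sup>+ \<omega>h. indicator A ((v, \<omega>), incr {k+1..N} (\<omega>, \<omega>h)) \<partial>Ph) \<partial>U k \<partial>P)"
  proof (rule nn_integral_cong_AE, use AE_hazard_path in eventually_elim)
    case (elim \<omega>)
    then have [measurable]: "\<omega> \<in> space P" by simp
    show ?case
      using nn_integral_incr_split[of \<omega> k "\<lambda>z. indicator A ((fst z, \<omega>), snd z)"] elim k by simp
  qed
  also have "\<dots> = (\<integral>\<^sup>+ v. \<integral>\<^sup>+ \<omega>. ennreal (dens_prod k v \<omega>) *
      (\<integral>\<^sup>+ \<omega>h. indicator A ((v, \<omega>), incr {k+1..N} (\<omega>, \<omega>h)) \<partial>Ph) \<partial>P \<partial>U k)"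
    by (rule UP.Fubini') (simp add: split_beta V_def[symmetric])
  also have "\<dots> = (\<integral>\<^sup>+ y. ennreal (dens_prod k (fst y) (snd y)) *
      (\<integral>\<^sup>+ \<omega>h. indicator A (y, incr {k+1..N} (snd y, \<omega>h)) \<partial>Ph) \<partial>V k)"
    unfolding V_def by (subst P.nn_integral_fst[symmetric]) (simp_all add: V_def[symmetric])
  also have "\<dots> = (\<integral>\<^sup>+ y. \<integral>\<^sup>+ \<omega>h. ennreal (dens_prod k (fst y) (snd y)) *
      indicator A (y, incr {k+1..N} (snd y, \<omega>h)) \<partial>Ph \<partial>V k)"
    by (intro nn_integral_cong nn_integral_cmult[symmetric])
       (measurable, auto simp: V_def space_pair_measure)
  also have "\<dots> = (\<integral>\<^sup>+ z. ?d z * indicator A (?g z) \<partial>?W)"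
    by (subst Ph.nn_integral_fst[symmetric]) auto
  also have "\<dots> = emeasure (distr (density ?W ?d) ?R ?g) A"
  proof -
    have "emeasure (distr (density ?W ?d) ?R ?g) A = (\<integral>\<^sup>+ z. indicator A z \<partial>distr (density ?W ?d) ?R ?g)"
      by (rule nn_integral_indicator[symmetric]) simp
    also have "\<dots> = (\<integral>\<^sup>+ z. indicator A (?g z) \<partial>density ?W ?d)"
      by (rule nn_integral_distr) measurable
    also have "\<dots> = (\<integral>\<^sup>+ z. ?d z * indicator A (?g z) \<partial>?W)"
      by (rule nn_integral_density) measurable
    finally show ?thesis by simp
  qed
  finally show "emeasure (distr ?M ?R ?f) A = emeasure (distr (density ?W ?d) ?R ?g) A" .
qed simp

section \<open>Adaptedness of hazards and densities up to null sets\<close>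

lemma AE_measurable_mono:
  assumes "AE_measurable P (F s) h" "0 \<le> s" "s \<le> r"
  shows "AE_measurable P (F r) h"
proof -
  have "subalgebra (F r) (F s)"
    using F_mono[OF assms(2,3)] F_space[of s] F_space[of r] assms(2,3) by (simp add: subalgebra_def)
  then show ?thesis
    using assms(1) measurable_from_subalg[of "F r" "F s"] by (auto simp: AE_measurable_def)
qed

text \<open>The process is only assumed measurable and adapted, not progressively measurable, so its
  integral is adapted only up to null sets.\<close>

lemma cumhaz_AE_measurable:
  assumes n: "n \<in> {1..N}" and r: "0 \<le> r"
  shows "AE_measurable P (F r) (\<lambda>\<omega>. enn2real (cumhaz (lam n) r \<omega>))"
proof -
  interpret exp_law: prob_space exp_law by (rule prob_space_exp_law)
  interpret nP: pair_prob_space exp_law P ..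
  have sub: "subalgebra P (F r)" using r by (rule F_subalgebra)
  \<comment> \<open>Cutting the integrand off after time \<open>r\<close> makes every section in
    time \<open>F r\<close>-measurable up to null sets, as \<open>AE_measurable_pair\<close>
    requires.\<close>
  define h where "h x = (if fst x \<le> r then (if 0 \<le> fst x then lam n (fst x) (snd x) else 0) else 0)" for x
  have [measurable]: "(\<lambda>x. if 0 \<le> fst x then lam n (fst x) (snd x) else 0) \<in> borel_measurable (exp_law \<Otimes>\<^sub>M P)"
    by (rule lam0_measurable[OF n]) auto
  have h [measurable]: "h \<in> borel_measurable (exp_law \<Otimes>\<^sub>M P)"
    unfolding h_def[abs_def] by (rule measurable_If) measurable
  have "AE_measurable (exp_law \<Otimes>\<^sub>M P) (exp_law \<Otimes>\<^sub>M F r) h"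
  proof (rule AE_measurable_pair[OF prob_space_exp_law P_prob sub h], rule AE_I2)
    fix u
    show "AE_measurable P (F r) (\<lambda>\<omega>. h (u, \<omega>))"
    proof (cases "0 \<le> u \<and> u \<le> r")
      case True
      then have "AE_measurable P (F u) (lam n u)"
        using lam_adapted[OF n, of u] by (intro AE_measurableI[of "lam n u"]) auto
      then show ?thesis using True AE_measurable_mono by (simp add: h_def)
    next
      case False
      then show ?thesis by (intro AE_measurableI[of "\<lambda>_. 0"]) (auto simp: h_def)
    qed
  qed
  then obtain h' where h'F [measurable]: "h' \<in> borel_measurable (exp_law \<Otimes>\<^sub>M F r)"
    and eq: "AE x in exp_law \<Otimes>\<^sub>M P. h x = h' x" by (auto simp: AE_measurable_def)
  have [measurable]: "h' \<in> borel_measurable (exp_law \<Otimes>\<^sub>M P)"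
    by (rule measurable_from_subalg[OF subalgebra_pair_measure[OF sub] h'F])
  have "AE u in exp_law. AE \<omega> in P. h (u, \<omega>) = h' (u, \<omega>)"
    using nP.AE_pair[OF eq] .
  \<comment> \<open>After the exchange of quantifiers, for almost every scenario the two integrands
    agree at Lebesgue-almost all nonnegative times, so their integrals agree.\<close>
  then have "AE \<omega> in P. AE u in exp_law. h (u, \<omega>) = h' (u, \<omega>)"
    by (subst (asm) nP.AE_commute) measurable
  then have "AE \<omega> in P. enn2real (cumhaz (lam n) r \<omega>)
      = enn2real (\<integral>\<^sup>+ s. (if 0 \<le> s \<and> s \<le> r then ennreal (h' (s, \<omega>)) else 0) \<partial>lborel)"
  proof eventually_elim
    case (elim \<omega>)
    then have "AE s in lborel. 0 \<le> s \<longrightarrow> h (s, \<omega>) = h' (s, \<omega>)" by (simp add: AE_exp_law)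
    then show ?case
      unfolding cumhaz_def
      by (intro arg_cong[where f=enn2real] nn_integral_cong_AE) (auto simp: h_def split: split_indicator)
  qed
  moreover have "(\<lambda>\<omega>. enn2real (\<integral>\<^sup>+ s. (if 0 \<le> s \<and> s \<le> r then ennreal (h' (s, \<omega>)) else 0) \<partial>lborel))
      \<in> borel_measurable (F r)"
  proof -
    have "h' \<in> borel_measurable (borel \<Otimes>\<^sub>M F r)"
      using h'F by (simp cong: measurable_cong_sets sets_pair_measure_cong)
    then have [measurable]: "(\<lambda>y. h' (snd y, fst y)) \<in> borel_measurable (F r \<Otimes>\<^sub>M lborel)"
      by (rule measurable_compose[rotated]) measurable
    show ?thesis
      by (intro borel_measurable_enn2real lborel.borel_measurable_nn_integral) (simp add: split_beta)
  qed
  ultimately show ?thesis by (intro AE_measurableI)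
qed

text \<open>The density at time \<open>s\<close> involves the intensity at \<open>s\<close> and its
  integral up to \<open>s\<close>, hence only information available by \<open>s\<close>.\<close>

lemma dens_AE_measurable:
  assumes n: "n \<in> {1..N}" and s: "s \<le> r" and r: "0 \<le> r"
  shows "AE_measurable P (F r) (dens n s)"
proof (cases "0 \<le> s")
  case True
  have "AE_measurable P (F s) (lam n s)"
    using lam_adapted[OF n True] by (intro AE_measurableI[of "lam n s"]) auto
  moreover have "AE_measurable P (F s) (\<lambda>\<omega>. exp (- enn2real (cumhaz (lam n) s \<omega>)) * exp s)"
    by (rule AE_measurable_compose[OF cumhaz_AE_measurable[OF n True], of "\<lambda>x. exp (- x) * exp s"]) simp
  ultimately have "AE_measurable P (F s) (\<lambda>\<omega>. lam n s \<omega> * (exp (- enn2real (cumhaz (lam n) s \<omega>)) * exp s))"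
    by (rule AE_measurable_mult)
  then show ?thesis
    using AE_measurable_mono[OF _ True s] True by (simp add: dens_def[abs_def] mult.assoc)
next
  case False
  then show ?thesis by (intro AE_measurableI[of "\<lambda>_. 0"]) (auto simp: dens_def)
qed

lemma incr_split_measurable:
  assumes k: "k \<le> N"
  shows "(\<lambda>x. ((incr {1..k} x, fst x), incr {k+1..N} x)) \<in> P \<Otimes>\<^sub>M Ph \<rightarrow>\<^sub>M V k \<Otimes>\<^sub>M PiM {k+1..N} (\<lambda>_. borel)"
    and "(\<lambda>z. (fst z, incr {k+1..N} (snd (fst z), snd z))) \<in> V k \<Otimes>\<^sub>M Ph \<rightarrow>\<^sub>M V k \<Otimes>\<^sub>M PiM {k+1..N} (\<lambda>_. borel)"
    and "(\<lambda>y. dens_prod k (fst y) (snd y)) \<in> borel_measurable (V k)"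
proof -
  have i1 [measurable]: "incr {1..k} \<in> P \<Otimes>\<^sub>M Ph \<rightarrow>\<^sub>M PiM {1..k} (\<lambda>_. borel)"
    using incr_measurable[of "{1..k}" "\<lambda>x. x"] k by auto
  have i2 [measurable]: "incr {k+1..N} \<in> P \<Otimes>\<^sub>M Ph \<rightarrow>\<^sub>M PiM {k+1..N} (\<lambda>_. borel)"
    using incr_measurable[of "{k+1..N}" "\<lambda>x. x"] by auto
  show "(\<lambda>x. ((incr {1..k} x, fst x), incr {k+1..N} x)) \<in> P \<Otimes>\<^sub>M Ph \<rightarrow>\<^sub>M V k \<Otimes>\<^sub>M PiM {k+1..N} (\<lambda>_. borel)"
    by measurable
  show "(\<lambda>z. (fst z, incr {k+1..N} (snd (fst z), snd z))) \<in> V k \<Otimes>\<^sub>M Ph \<rightarrow>\<^sub>M V k \<Otimes>\<^sub>M PiM {k+1..N} (\<lambda>_. borel)"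
    by measurable
  show "(\<lambda>y. dens_prod k (fst y) (snd y)) \<in> borel_measurable (V k)"
    by (rule dens_prod_measurable[OF k]) measurable
qed

lemma space_V: "space (V k) = (\<Pi>\<^sub>E j\<in>{1..k}. UNIV) \<times> space P"
  by (simp add: V_def space_pair_measure space_PiM)

text \<open>\<open>distr_incr_split\<close> for signed integrands: both sides integrate the same
  \<open>K\<close> against the same image measure, so integrability passes in either
  direction.\<close>

lemma
  fixes K :: "((nat \<Rightarrow> real) \<times> 'a) \<times> (nat \<Rightarrow> real) \<Rightarrow> real"
  assumes k: "k \<le> N" and K [measurable]: "K \<in> borel_measurable (V k \<Otimes>\<^sub>M PiM {k+1..N} (\<lambda>_. borel))"
  shows integrable_incr_split:
      "integrable (P \<Otimes>\<^sub>M Ph) (\<lambda>x. K ((incr {1..k} x, fst x), incr {k+1..N} x)) \<longleftrightarrow>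
       integrable (V k \<Otimes>\<^sub>M Ph) (\<lambda>z. dens_prod k (fst (fst z)) (snd (fst z)) *
         K (fst z, incr {k+1..N} (snd (fst z), snd z)))"
    and integral_incr_split:
      "(\<integral>x. K ((incr {1..k} x, fst x), incr {k+1..N} x) \<partial>(P \<Otimes>\<^sub>M Ph)) =
       (\<integral>z. dens_prod k (fst (fst z)) (snd (fst z)) *
         K (fst z, incr {k+1..N} (snd (fst z), snd z)) \<partial>(V k \<Otimes>\<^sub>M Ph))"
proof -
  note incr_split_measurable[OF k, measurable]
  have nonneg: "AE z in V k \<Otimes>\<^sub>M Ph. 0 \<le> dens_prod k (fst (fst z)) (snd (fst z))"
    by (rule AE_I2) (auto simp: space_pair_measure space_V intro!: dens_prod_nonneg[OF k])
  show "integrable (P \<Otimes>\<^sub>M Ph) (\<lambda>x. K ((incr {1..k} x, fst x), incr {k+1..N} x)) \<longleftrightarrow>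
       integrable (V k \<Otimes>\<^sub>M Ph) (\<lambda>z. dens_prod k (fst (fst z)) (snd (fst z)) *
         K (fst z, incr {k+1..N} (snd (fst z), snd z)))"
    using distr_incr_split[OF k] nonneg
    by (subst integrable_distr_eq[symmetric, of _ _ "V k \<Otimes>\<^sub>M PiM {k+1..N} (\<lambda>_. borel)"])
       (simp_all add: integrable_distr_eq integrable_real_density integrable_density)
  show "(\<integral>x. K ((incr {1..k} x, fst x), incr {k+1..N} x) \<partial>(P \<Otimes>\<^sub>M Ph)) =
       (\<integral>z. dens_prod k (fst (fst z)) (snd (fst z)) *
         K (fst z, incr {k+1..N} (snd (fst z), snd z)) \<partial>(V k \<Otimes>\<^sub>M Ph))"
    using distr_incr_split[OF k] nonneg
    by (subst integral_distr[symmetric, of _ _ "V k \<Otimes>\<^sub>M PiM {k+1..N} (\<lambda>_. borel)"])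
       (simp_all add: integral_distr integral_density)
qed

text \<open>This is the absolute continuity that legitimizes inserting the random times: a property
  of almost all frozen values, drawn independently of the scenario, still holds almost surely at the
  true waiting times.\<close>

lemma AE_incr:
  assumes k: "k \<le> N" and R: "AE y in V k. R y" and [measurable]: "Measurable.pred (V k) R"
  shows "AE x in P \<Otimes>\<^sub>M Ph. R (incr {1..k} x, fst x)"
proof -
  note incr_split_measurable[OF k, measurable]
  let ?R = "V k \<Otimes>\<^sub>M PiM {k+1..N} (\<lambda>_. borel) :: (((nat \<Rightarrow> real) \<times> 'a) \<times> (nat \<Rightarrow> real)) measure"
  have "AE z in V k \<Otimes>\<^sub>M Ph. R (fst z)"
    by (rule VPh.AE_pair_measure) (use R in auto)
  then have "AE u in distr (density (V k \<Otimes>\<^sub>M Ph) (\<lambda>z. ennreal (dens_prod k (fst (fst z)) (snd (fst z)))))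
      ?R (\<lambda>z. (fst z, incr {k+1..N} (snd (fst z), snd z))). R (fst u)"
    by (subst AE_distr_iff) (auto simp: AE_density)
  then show ?thesis
    unfolding distr_incr_split[OF k, symmetric] by (subst (asm) AE_distr_iff) auto
qed

end

section \<open>The conditional expectation on each stage\<close>

definition partial_sum :: "(nat \<Rightarrow> real) \<Rightarrow> nat \<Rightarrow> real" where
  "partial_sum v l = (\<Sum>j=1..l. v j)"

locale default_claim = default_times P Ph F N E lam
  for P :: "'a measure" and Ph :: "'b measure" and F :: "real \<Rightarrow> 'a measure" and N :: nat
    and E :: "nat \<Rightarrow> 'b \<Rightarrow> real" and lam :: "nat \<Rightarrow> real \<Rightarrow> 'a \<Rightarrow> real" +
  fixes t :: real and Y :: "'a \<times> 'b \<Rightarrow> real" and \<phi> :: "(nat \<Rightarrow> real) \<Rightarrow> 'a \<Rightarrow> real"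
    and g :: "nat \<Rightarrow> (nat \<Rightarrow> real) \<Rightarrow> 'a \<Rightarrow> real"
  assumes N_pos: "1 \<le> N" and t_nonneg: "0 \<le> t"
    and Y_int: "integrable (P \<Otimes>\<^sub>M Ph) Y"
    and \<phi>_meas: "(\<lambda>(u, \<omega>). \<phi> u \<omega>) \<in>
        borel_measurable (PiM {1..N} (\<lambda>_. restrict_space borel {0..}) \<Otimes>\<^sub>M Finf P F)"
    and Y_eq: "\<And>x. x \<in> space (P \<Otimes>\<^sub>M Ph) \<Longrightarrow> Y x = \<phi> (tauvec lam E N x) (fst x)"
    and g_meas: "\<And>k. k \<in> {1..N} \<Longrightarrow>
        (\<lambda>(u, \<omega>). g k u \<omega>) \<in> borel_measurable (PiM {1..k} (\<lambda>_. borel) \<Otimes>\<^sub>M P)"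
    and g_version: "\<And>k u. k \<in> {1..N} \<Longrightarrow> u \<in> (\<Pi>\<^sub>E i\<in>{1..k}. {0..}) \<Longrightarrow>
        AE \<omega> in P. g k u \<omega> = real_cond_exp P (F t)
          (\<lambda>\<omega>'. if k < N
                 then (\<integral>\<omega>h. (if t - u k < ttau lam E (Suc k) (\<omega>', \<omega>h) then 1 else 0)
                              * \<phi> (uext lam E N k u (\<omega>', \<omega>h)) \<omega>' \<partial>Ph)
                 else \<phi> u \<omega>') \<omega>"
begin

text \<open>Nothing is known about \<open>\<phi>\<close> outside the nonnegative vectors.\<close>

definition \<phi>_pos :: "(nat \<Rightarrow> real) \<Rightarrow> 'a \<Rightarrow> real" where
  "\<phi>_pos u \<omega> = \<phi> (\<lambda>l\<in>{1..N}. max 0 (u l)) \<omega>"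

text \<open>The counterpart of \<open>uext\<close> in waiting-time coordinates: all default times
  when the first \<open>k\<close> waiting times are \<open>v\<close> and the later ones are read off
  \<open>z\<close>.\<close>

definition tau_ext :: "nat \<Rightarrow> (nat \<Rightarrow> real) \<Rightarrow> (nat \<Rightarrow> real) \<Rightarrow> nat \<Rightarrow> real" where
  "tau_ext k v z = (\<lambda>l\<in>{1..N}. if l \<le> k then partial_sum v l else partial_sum v k + (\<Sum>m=k+1..l. z m))"

text \<open>For \<open>k = N\<close> the condition is void, in keeping with the convention that the
  default time after the last one is infinite.\<close>

definition survives :: "nat \<Rightarrow> (nat \<Rightarrow> real) \<Rightarrow> (nat \<Rightarrow> real) \<Rightarrow> real" where
  "survives k v z = (if k < N \<longrightarrow> t - partial_sum v k < z (k+1) then 1 else 0)"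

text \<open>One expression for the inner expectation in all three kinds of terms:
  \<open>k = 0\<close> gives the term before the first default, and for \<open>k = N\<close> the
  integrand is constant in \<open>\<omega>h\<close>.\<close>

definition payoff :: "nat \<Rightarrow> (nat \<Rightarrow> real) \<Rightarrow> 'a \<Rightarrow> real" where
  "payoff k v \<omega> = (\<integral>\<omega>h. survives k v (incr {k+1..N} (\<omega>, \<omega>h)) * \<phi>_pos (tau_ext k v (incr {k+1..N} (\<omega>, \<omega>h))) \<omega> \<partial>Ph)"

text \<open>Only for positive \<open>k\<close> is a version supplied by hypothesis. For
  \<open>k = 0\<close> there is no parameter to substitute, and the conditional expectation itself
  is used.\<close>

definition g_incr :: "nat \<Rightarrow> (nat \<Rightarrow> real) \<Rightarrow> 'a \<Rightarrow> real" where
  "g_incr k v \<omega> = (if k = 0 then real_cond_exp P (F t)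
       (\<lambda>\<omega>. \<integral>\<omega>h. (if t < tau lam E 1 (\<omega>, \<omega>h) then 1 else 0) * Y (\<omega>, \<omega>h) \<partial>Ph) \<omega>
     else g k (\<lambda>l\<in>{1..k}. partial_sum v l) \<omega>)"

text \<open>The value 0 at \<open>k = N\<close> makes the prefactor 1, so the last term needs no
  separate treatment.\<close>

definition haz_exponent :: "nat \<Rightarrow> (nat \<Rightarrow> real) \<Rightarrow> 'a \<Rightarrow> real" where
  "haz_exponent k v \<omega> = (if k < N then enn2real (cumhaz (lam (Suc k)) (t - partial_sum v k) \<omega>) else 0)"

lemma \<phi>_pos_measurable: "(\<lambda>x. \<phi>_pos (fst x) (snd x)) \<in> borel_measurable (PiM {1..N} (\<lambda>_. borel) \<Otimes>\<^sub>M P)"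
proof -
  have sub: "(\<Union>t\<in>{0..}. sets (F t)) \<subseteq> sets P" using F_sub by auto
  then have "(\<Union>t\<in>{0..}. sets (F t)) \<subseteq> Pow (space P)" using sets.space_closed[of P] by blast
  then have Finf: "space (Finf P F) = space P" "sets (Finf P F) \<subseteq> sets P"
    unfolding Finf_def using sets.sigma_sets_subset[OF sub] by simp_all
  have id [measurable]: "(\<lambda>x. x) \<in> P \<rightarrow>\<^sub>M Finf P F"
    using Finf by (intro measurableI) auto
  have [measurable]: "(\<lambda>x. \<lambda>l\<in>{1..N}. max 0 (fst x l)) \<in> (PiM {1..N} (\<lambda>_. borel) \<Otimes>\<^sub>M P)
      \<rightarrow>\<^sub>M PiM {1..N} (\<lambda>_. restrict_space borel {0::real..})"
  proof (intro measurable_restrict measurable_restrict_space2)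
    fix i assume i: "i \<in> {1..N}"
    show "(\<lambda>x. max 0 (fst x i :: real)) \<in> borel_measurable (PiM {1..N} (\<lambda>_. borel) \<Otimes>\<^sub>M P)"
      by (intro borel_measurable_max borel_measurable_const
            measurable_compose[OF measurable_fst measurable_component_singleton[OF i]])
  qed auto
  have "(\<lambda>x. case ((\<lambda>l\<in>{1..N}. max 0 (fst x l)), snd x) of (u, \<omega>) \<Rightarrow> \<phi> u \<omega>)
      \<in> borel_measurable (PiM {1..N} (\<lambda>_. borel) \<Otimes>\<^sub>M P)"
    by (rule measurable_compose[OF _ \<phi>_meas]) measurable
  then show ?thesis by (simp add: \<phi>_pos_def)
qed

lemma partial_sum_measurable: "l \<le> k \<Longrightarrow> (\<lambda>y. partial_sum (fst y) l) \<in> borel_measurable (PiM {1..k} (\<lambda>_. borel) \<Otimes>\<^sub>M Q)"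
  unfolding partial_sum_def
  by (intro borel_measurable_sum measurable_compose[OF measurable_fst measurable_component_singleton]) auto

lemma partial_sum_measurable_V: "l \<le> k \<Longrightarrow> (\<lambda>y. partial_sum (fst y) l) \<in> borel_measurable (V k)"
  using partial_sum_measurable[of l k P] by (simp cong: measurable_cong_sets add: sets_V)

lemma survives_measurable:
  "k \<le> N \<Longrightarrow> (\<lambda>x. survives k (fst (fst x)) (snd x)) \<in> borel_measurable (V k \<Otimes>\<^sub>M PiM {k+1..N} (\<lambda>_. borel))"
proof (cases "k < N")
  case True
  then have [measurable]: "k + 1 \<in> {k+1..N}" by simp
  note partial_sum_measurable_V[of k k, measurable]
  have "(\<lambda>x. if t - partial_sum (fst (fst x)) k < snd x (k+1) then 1 else 0 :: real)
      \<in> borel_measurable (V k \<Otimes>\<^sub>M PiM {k+1..N} (\<lambda>_. borel))" by measurable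
  then show ?thesis using True by (simp add: survives_def)
next
  case False
  then show ?thesis by (simp add: survives_def)
qed

lemma tau_ext_measurable:
  "k \<le> N \<Longrightarrow> (\<lambda>x. tau_ext k (fst (fst x)) (snd x)) \<in> V k \<Otimes>\<^sub>M PiM {k+1..N} (\<lambda>_. borel) \<rightarrow>\<^sub>M PiM {1..N} (\<lambda>_. borel)"
  unfolding tau_ext_def
proof (intro measurable_restrict)
  fix i assume i: "i \<in> {1..N}"
  let ?R = "V k \<Otimes>\<^sub>M PiM {k+1..N} (\<lambda>_. borel) :: (((nat \<Rightarrow> real) \<times> 'a) \<times> (nat \<Rightarrow> real)) measure"
  have "(\<lambda>x. partial_sum (fst (fst x)) l) \<in> borel_measurable ?R" if "l \<le> k" for l
    by (rule measurable_compose[OF measurable_fst partial_sum_measurable_V[OF that]])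
  moreover have "(\<lambda>x. \<Sum>m=k+1..i. snd x m) \<in> borel_measurable ?R"
    using i by (intro borel_measurable_sum measurable_compose[OF measurable_snd measurable_component_singleton]) auto
  ultimately show "(\<lambda>x. if i \<le> k then partial_sum (fst (fst x)) i else partial_sum (fst (fst x)) k + (\<Sum>m=k+1..i. snd x m))
      \<in> borel_measurable ?R"
    by (cases "i \<le> k") auto
qed

lemma \<phi>_pos_tau_ext_measurable:
  assumes k: "k \<le> N"
  shows "(\<lambda>x. \<phi>_pos (tau_ext k (fst (fst x)) (snd x)) (snd (fst x)))
    \<in> borel_measurable (V k \<Otimes>\<^sub>M PiM {k+1..N} (\<lambda>_. borel))"
proof -
  note tau_ext_measurable[OF k, measurable]
  have "(\<lambda>x. (tau_ext k (fst (fst x)) (snd x), snd (fst x)))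
    \<in> V k \<Otimes>\<^sub>M PiM {k+1..N} (\<lambda>_. borel) \<rightarrow>\<^sub>M PiM {1..N} (\<lambda>_. borel) \<Otimes>\<^sub>M P" by measurable
  from measurable_compose[OF this \<phi>_pos_measurable] show ?thesis by simp
qed

lemma payoff_measurable:
  assumes k: "k \<le> N"
  shows "(\<lambda>y. payoff k (fst y) (snd y)) \<in> borel_measurable (V k)"
proof -
  note survives_measurable[OF k, measurable] \<phi>_pos_tau_ext_measurable[OF k, measurable] incr_split_measurable[OF k, measurable]
  have "(\<lambda>z. (\<lambda>x. survives k (fst (fst x)) (snd x) * \<phi>_pos (tau_ext k (fst (fst x)) (snd x)) (snd (fst x)))
       (fst z, incr {k+1..N} (snd (fst z), snd z))) \<in> borel_measurable (V k \<Otimes>\<^sub>M Ph)"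
    by (rule measurable_compose[OF incr_split_measurable(2)[OF k]]) measurable
  then show ?thesis
    unfolding payoff_def by (intro Ph.borel_measurable_lebesgue_integral) (simp add: split_beta)
qed

lemma g_incr_measurable:
  assumes k: "k \<le> N"
  shows "(\<lambda>y. g_incr k (fst y) (snd y)) \<in> borel_measurable (V k)"
proof (cases "k = 0")
  case True
  then show ?thesis
    by (auto simp: g_incr_def V_def intro!: measurable_compose[OF measurable_snd borel_measurable_cond_exp2])
next
  case False
  have "(\<lambda>y. \<lambda>l\<in>{1..k}. partial_sum (fst y) l) \<in> V k \<rightarrow>\<^sub>M PiM {1..k} (\<lambda>_. borel)"
    by (intro measurable_restrict partial_sum_measurable_V) auto
  then have "(\<lambda>y. (\<lambda>l\<in>{1..k}. partial_sum (fst y) l, snd y)) \<in> V k \<rightarrow>\<^sub>M PiM {1..k} (\<lambda>_. borel) \<Otimes>\<^sub>M P"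
    by measurable
  from measurable_compose[OF this g_meas[of k]] show ?thesis using False k by (simp add: g_incr_def)
qed

lemma haz_exponent_measurable:
  assumes k: "k \<le> N"
  shows "(\<lambda>y. haz_exponent k (fst y) (snd y)) \<in> borel_measurable (V k)"
proof (cases "k < N")
  case True
  note partial_sum_measurable_V[of k k, measurable]
  have [measurable]: "(\<lambda>y. cumhaz (lam (Suc k)) (t - partial_sum (fst y) k) (snd y)) \<in> borel_measurable (V k)"
    by (rule cumhaz_measurable) (use True in auto)
  show ?thesis using True by (simp add: haz_exponent_def)
next
  case False
  then show ?thesis by (simp add: haz_exponent_def)
qed

section \<open>Translation between default times and waiting times\<close>

lemma tau_nonneg: "0 \<le> tau lam E n x"
  unfolding tau_def by (intro sum_nonneg ttau_nonneg)

lemma partial_sum_incr: "l \<le> k \<Longrightarrow> partial_sum (incr {1..k} x) l = tau lam E l x"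
  unfolding partial_sum_def tau_def incr_def by (intro sum.cong) auto

lemma tau_split: "k \<le> l \<Longrightarrow> tau lam E l x = tau lam E k x + (\<Sum>m=k+1..l. ttau lam E m x)"
  unfolding tau_def using sum.ub_add_nat[of 1 k "\<lambda>m. ttau lam E m x" "l - k"] by simp

lemma sum_incr: "l \<le> N \<Longrightarrow> (\<Sum>m=k+1..l. incr {k+1..N} x m) = (\<Sum>m=k+1..l. ttau lam E m x)"
  unfolding incr_def by (intro sum.cong) auto

lemma tau_ext_incr: "tau_ext k (incr {1..k} x) (incr {k+1..N} x) = tauvec lam E N x"
  unfolding tau_ext_def tauvec_def
proof (rule restrict_ext)
  fix l assume "l \<in> {1..N}"
  then show "(if l \<le> k then partial_sum (incr {1..k} x) l
      else partial_sum (incr {1..k} x) k + (\<Sum>m=k+1..l. incr {k+1..N} x m)) = tau lam E l x"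
    using tau_split[of k l x] by (simp add: partial_sum_incr sum_incr)
qed

lemma Y_eq_tau_ext:
  assumes "k \<le> N" "x \<in> space (P \<Otimes>\<^sub>M Ph)"
  shows "Y x = \<phi>_pos (tau_ext k (incr {1..k} x) (incr {k+1..N} x)) (fst x)"
proof -
  have "(\<lambda>l\<in>{1..N}. max 0 (tauvec lam E N x l)) = tauvec lam E N x"
    by (auto simp: tauvec_def fun_eq_iff tau_nonneg max_def)
  then show ?thesis using Y_eq[OF assms(2)] tau_ext_incr[of k x] by (simp add: \<phi>_pos_def)
qed

lemma partial_sum_nonneg: "v \<in> (\<Pi>\<^sub>E j\<in>{1..k}. {0..}) \<Longrightarrow> l \<le> k \<Longrightarrow> 0 \<le> partial_sum v l"
  unfolding partial_sum_def by (intro sum_nonneg) (auto simp: PiE_iff)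

text \<open>Nonnegative waiting times produce nonnegative default times, so the truncation in
  \<open>\<phi>_pos\<close> does nothing and the vector of the statement is recovered
  exactly.\<close>

lemma uext_eq_tau_ext:
  assumes k: "k \<le> N" and v: "v \<in> (\<Pi>\<^sub>E j\<in>{1..k}. {0..})" and u: "\<And>l. l \<in> {1..k} \<Longrightarrow> u l = partial_sum v l"
    and u0: "k = 0 \<Longrightarrow> u k = 0"
  shows "\<phi> (uext lam E N k u x) \<omega> = \<phi>_pos (tau_ext k v (incr {k+1..N} x)) \<omega>"
proof -
  have uk: "u k = partial_sum v k" using u[of k] u0 by (cases "k = 0") (auto simp: partial_sum_def)
  have "uext lam E N k u x l = (\<lambda>l\<in>{1..N}. max 0 (tau_ext k v (incr {k+1..N} x) l)) l" for l
  proof (cases "l \<in> {1..N}")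
    case True
    have "0 \<le> (\<Sum>m=k+1..l. ttau lam E m x)" by (intro sum_nonneg ttau_nonneg)
    then show ?thesis
      using True u[of l] partial_sum_nonneg[OF v, of l] partial_sum_nonneg[OF v, of k] uk sum_incr[of l k x]
      by (auto simp: uext_def tau_ext_def)
  next
    case False
    then show ?thesis unfolding uext_def restrict_def by (simp only: if_False)
  qed
  then have "uext lam E N k u x = (\<lambda>l\<in>{1..N}. max 0 (tau_ext k v (incr {k+1..N} x) l))"
    by (rule HOL.ext)
  then show ?thesis by (simp only: \<phi>_pos_def)
qed

lemma payoff_section_measurable:
  assumes "k \<le> N" "v \<in> (\<Pi>\<^sub>E j\<in>{1..k}. UNIV)"
  shows "payoff k v \<in> borel_measurable P"
  using measurable_compose[OF measurable_Pair1'[of v "U k" P] payoff_measurable[OF assms(1), unfolded V_def]] assms(2)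
  by (simp add: space_PiM)

text \<open>Partial sums of nonnegative waiting times are nonnegative, so the hypothesis on
  \<open>g\<close> applies to them; in each case the function being conditioned is
  \<open>payoff k v\<close>. The null set still depends on \<open>v\<close>.\<close>

lemma g_incr_version:
  assumes k: "k \<le> N" and v: "v \<in> (\<Pi>\<^sub>E j\<in>{1..k}. {0..})"
  shows "AE \<omega> in P. g_incr k v \<omega> = real_cond_exp P (F t) (payoff k v) \<omega>"
proof -
  have v': "v \<in> (\<Pi>\<^sub>E j\<in>{1..k}. UNIV)" using v by auto
  note cong = real_cond_exp_cong_space[OF P_prob F_subalgebra[OF t_nonneg] _ payoff_section_measurable[OF k v']]
  show ?thesis
  proof (cases "k = 0")
    case True
    have "(\<integral>\<omega>h. (if t < tau lam E 1 (\<omega>, \<omega>h) then 1 else 0) * Y (\<omega>, \<omega>h) \<partial>Ph) = payoff k v \<omega>"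
      if \<omega>: "\<omega> \<in> space P" for \<omega>
      unfolding payoff_def
    proof (rule Bochner_Integration.integral_cong[OF refl])
      fix \<omega>h assume \<omega>h: "\<omega>h \<in> space Ph"
      have "Y (\<omega>, \<omega>h) = \<phi>_pos (tau_ext 0 (incr {1..0} (\<omega>, \<omega>h)) (incr {0+1..N} (\<omega>, \<omega>h))) \<omega>"
        using Y_eq_tau_ext[of 0 "(\<omega>, \<omega>h)"] \<omega> \<omega>h by (simp add: space_pair_measure)
      moreover have "tau_ext 0 (incr {1..0} (\<omega>, \<omega>h)) z = tau_ext k v z" for z
        using True by (auto simp: tau_ext_def partial_sum_def fun_eq_iff)
      moreover have "survives k v (incr {k+1..N} (\<omega>, \<omega>h)) = (if t < tau lam E 1 (\<omega>, \<omega>h) then 1 else 0)"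
        using True N_pos by (simp add: survives_def partial_sum_def incr_def tau_def)
      ultimately show "(if t < tau lam E 1 (\<omega>, \<omega>h) then 1 else 0) * Y (\<omega>, \<omega>h)
          = survives k v (incr {k+1..N} (\<omega>, \<omega>h)) * \<phi>_pos (tau_ext k v (incr {k+1..N} (\<omega>, \<omega>h))) \<omega>"
        using True by simp
    qed
    from cong[OF this] show ?thesis using True by (simp add: g_incr_def)
  next
    case False
    define u where "u = (\<lambda>l\<in>{1..k}. partial_sum v l)"
    have uk: "u k = partial_sum v k" using False by (simp add: u_def)
    have u: "u \<in> (\<Pi>\<^sub>E i\<in>{1..k}. {0..})"
      unfolding u_def using partial_sum_nonneg[OF v] by auto
    have uext: "\<phi> (uext lam E N k u x) \<omega> = \<phi>_pos (tau_ext k v (incr {k+1..N} x)) \<omega>" for x \<omega>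
      by (rule uext_eq_tau_ext[OF k v]) (use False in \<open>auto simp: u_def\<close>)
    have eq: "(if k < N
         then (\<integral>\<omega>h. (if t - u k < ttau lam E (Suc k) (\<omega>, \<omega>h) then 1 else 0)
                    * \<phi> (uext lam E N k u (\<omega>, \<omega>h)) \<omega> \<partial>Ph)
         else \<phi> u \<omega>) = payoff k v \<omega>" for \<omega>
    proof (cases "k < N")
      case True
      then show ?thesis
        by (auto simp: payoff_def uext uk survives_def incr_def[of "{k+1..N}"] Suc_eq_plus1
            intro!: Bochner_Integration.integral_cong)
    next
      case False
      then have "k = N" using k by simp
      \<comment> \<open>At the last stage no waiting time is left to integrate out, and integrating
        a constant over the probability \<open>Ph\<close> returns it.\<close>
      then have "uext lam E N k u x = u" for x
        by (auto simp: uext_def u_def fun_eq_iff)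
      then have "\<phi>_pos (tau_ext k v (incr {k+1..N} x)) \<omega> = \<phi> u \<omega>" for x
        using uext[of x \<omega>] by simp
      then show ?thesis using False by (simp add: payoff_def survives_def Ph.prob_space)
    qed
    from g_version[of k u] have "AE \<omega> in P. g k u \<omega> = real_cond_exp P (F t) (payoff k v) \<omega>"
      using u k False unfolding eq by simp
    then show ?thesis using False by (simp add: g_incr_def u_def)
  qed
qed

text \<open>The reference law charges only nonnegative times, so the versions, prescribed for
  nonnegative vectors only, are available for almost every frozen \<open>v\<close>.\<close>

lemma AE_U_nonneg: "AE v in U k. v \<in> (\<Pi>\<^sub>E j\<in>{1..k}. {0..})"
proof -
  have "AE v in U k. \<forall>j\<in>{1..k}. 0 \<le> v j"
  proof (rule AE_finite_allI)
    fix j assume "j \<in> {1..k}"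
    then show "AE v in U k. 0 \<le> v j"
      by (intro AE_PiM_component[where P="\<lambda>s. 0 \<le> s"] prob_space_exp_law) (auto simp: AE_exp_law)
  qed simp
  then show ?thesis
    using AE_space by eventually_elim (auto simp: space_PiM PiE_iff)
qed

text \<open>The cut-off is the part of the stage event that depends on the first \<open>k\<close>
  waiting times; without it the density could use information from after \<open>t\<close>.\<close>

definition weight :: "nat \<Rightarrow> (nat \<Rightarrow> real) \<Rightarrow> 'a \<Rightarrow> real" where
  "weight k v \<omega> = dens_prod k v \<omega> * (if partial_sum v k \<le> t then 1 else 0)"

lemma weight_measurable:
  assumes k: "k \<le> N"
  shows "(\<lambda>y. weight k (fst y) (snd y)) \<in> borel_measurable (V k)"
proof -
  note partial_sum_measurable_V[of k k, measurable] incr_split_measurable(3)[OF k, measurable]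
  show ?thesis unfolding weight_def by measurable
qed

text \<open>Each intensity runs on its own clock, so the density of the \<open>j\<close>-th waiting
  time looks no further than \<open>v j\<close>; nonnegative summands with total at most
  \<open>t\<close> are each at most \<open>t\<close>.\<close>

lemma weight_AE_measurable:
  assumes k: "k \<le> N" and v: "v \<in> (\<Pi>\<^sub>E j\<in>{1..k}. {0..})"
  shows "AE_measurable P (F t) (weight k v)"
proof (cases "partial_sum v k \<le> t")
  case True
  have "v j \<le> t" if "j \<in> {1..k}" for j
    using member_le_sum[of j "{1..k}" v] v that True by (auto simp: partial_sum_def PiE_iff)
  then have "AE_measurable P (F t) (\<lambda>\<omega>. \<Prod>j=1..k. dens j (v j) \<omega>)"
    using k t_nonneg by (intro AE_measurable_prod dens_AE_measurable) auto
  then show ?thesis using True by (simp add: weight_def[abs_def] dens_prod_def)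
next
  case False
  then show ?thesis by (intro AE_measurableI[of "\<lambda>_. 0"]) (auto simp: weight_def)
qed

section \<open>Integrals over a stage\<close>

definition stage :: "nat \<Rightarrow> ('a \<times> 'b) set" where
  "stage k = {x \<in> space (P \<Otimes>\<^sub>M Ph). tau lam E k x \<le> t \<and> (k < N \<longrightarrow> t < tau lam E (Suc k) x)}"

lemma indicator_stage:
  assumes "k \<le> N" "x \<in> space (P \<Otimes>\<^sub>M Ph)"
  shows "indicator (stage k) x = (if partial_sum (incr {1..k} x) k \<le> t then 1 else 0)
     * survives k (incr {1..k} x) (incr {k+1..N} x)"
proof -
  have "tau lam E (Suc k) x = tau lam E k x + ttau lam E (k+1) x"
    using tau_split[of k "k + 1" x] by (simp add: Suc_eq_plus1)
  then show ?thesis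
    using assms by (auto simp: stage_def survives_def partial_sum_incr incr_def[of "{k+1..N}"] Suc_eq_plus1 split: split_indicator)
qed

lemma
  fixes \<eta> :: "((nat \<Rightarrow> real) \<times> 'a) \<times> (nat \<Rightarrow> real) \<Rightarrow> real"
  assumes k: "k \<le> N" and \<eta> [measurable]: "\<eta> \<in> borel_measurable (V k \<Otimes>\<^sub>M PiM {k+1..N} (\<lambda>_. borel))"
  shows integrable_on_stage:
      "integrable (P \<Otimes>\<^sub>M Ph) (\<lambda>x. indicator (stage k) x * \<eta> ((incr {1..k} x, fst x), incr {k+1..N} x)) \<longleftrightarrow>
       integrable (V k \<Otimes>\<^sub>M Ph) (\<lambda>z. weight k (fst (fst z)) (snd (fst z)) *
         (survives k (fst (fst z)) (incr {k+1..N} (snd (fst z), snd z)) * \<eta> (fst z, incr {k+1..N} (snd (fst z), snd z))))"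
    and integral_on_stage:
      "(\<integral>x. indicator (stage k) x * \<eta> ((incr {1..k} x, fst x), incr {k+1..N} x) \<partial>(P \<Otimes>\<^sub>M Ph)) =
       (\<integral>z. weight k (fst (fst z)) (snd (fst z)) *
         (survives k (fst (fst z)) (incr {k+1..N} (snd (fst z), snd z)) * \<eta> (fst z, incr {k+1..N} (snd (fst z), snd z)))
         \<partial>(V k \<Otimes>\<^sub>M Ph))"
proof -
  note partial_sum_measurable_V[of k k, measurable] survives_measurable[OF k, measurable]
  define K where "K x = (if partial_sum (fst (fst x)) k \<le> t then 1 else 0) * survives k (fst (fst x)) (snd x) * \<eta> x" for x
  have K: "K \<in> borel_measurable (V k \<Otimes>\<^sub>M PiM {k+1..N} (\<lambda>_. borel))"
    unfolding K_def[abs_def] by measurable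
  have 1: "indicator (stage k) x * \<eta> ((incr {1..k} x, fst x), incr {k+1..N} x)
      = K ((incr {1..k} x, fst x), incr {k+1..N} x)" if "x \<in> space (P \<Otimes>\<^sub>M Ph)" for x
    using indicator_stage[OF k that] by (simp add: K_def)
  have 2: "weight k (fst (fst z)) (snd (fst z)) *
         (survives k (fst (fst z)) (incr {k+1..N} (snd (fst z), snd z)) * \<eta> (fst z, incr {k+1..N} (snd (fst z), snd z)))
     = dens_prod k (fst (fst z)) (snd (fst z)) * K (fst z, incr {k+1..N} (snd (fst z), snd z))" for z
    by (simp add: weight_def K_def)
  show "integrable (P \<Otimes>\<^sub>M Ph) (\<lambda>x. indicator (stage k) x * \<eta> ((incr {1..k} x, fst x), incr {k+1..N} x)) \<longleftrightarrow>
       integrable (V k \<Otimes>\<^sub>M Ph) (\<lambda>z. weight k (fst (fst z)) (snd (fst z)) *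
         (survives k (fst (fst z)) (incr {k+1..N} (snd (fst z), snd z)) * \<eta> (fst z, incr {k+1..N} (snd (fst z), snd z))))"
    unfolding 2 integrable_incr_split[OF k K, symmetric]
    by (rule Bochner_Integration.integrable_cong[OF refl 1])
  show "(\<integral>x. indicator (stage k) x * \<eta> ((incr {1..k} x, fst x), incr {k+1..N} x) \<partial>(P \<Otimes>\<^sub>M Ph)) =
       (\<integral>z. weight k (fst (fst z)) (snd (fst z)) *
         (survives k (fst (fst z)) (incr {k+1..N} (snd (fst z), snd z)) * \<eta> (fst z, incr {k+1..N} (snd (fst z), snd z)))
         \<partial>(V k \<Otimes>\<^sub>M Ph))"
    unfolding 2 integral_incr_split[OF k K, symmetric]
    by (rule Bochner_Integration.integral_cong[OF refl 1])
qed

lemma tau_measurable: "k \<le> N \<Longrightarrow> tau lam E k \<in> borel_measurable (P \<Otimes>\<^sub>M Ph)"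
  unfolding tau_def[abs_def] using ttau_measurable[of _ "\<lambda>x. x"]
  by (intro borel_measurable_sum) auto

lemma stage_sets: "k \<le> N \<Longrightarrow> stage k \<in> sets (P \<Otimes>\<^sub>M Ph)"
proof -
  assume k: "k \<le> N"
  note tau_measurable[OF k, measurable]
  show ?thesis
  proof (cases "k < N")
    case True
    then have [measurable]: "tau lam E (Suc k) \<in> borel_measurable (P \<Otimes>\<^sub>M Ph)"
      by (intro tau_measurable) auto
    show ?thesis using True unfolding stage_def by simp
  next
    case False
    then show ?thesis unfolding stage_def by simp
  qed
qed

text \<open>Integrating out \<open>Ph\<close> on the stage leaves exactly \<open>payoff\<close>.
  Integrability is inherited from \<open>Y\<close> for the weighted product only; nothing is claimed
  about \<open>payoff\<close> by itself.\<close>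

lemma
  assumes k: "k \<le> N"
  shows integrable_weight_payoff: "integrable (V k) (\<lambda>y. weight k (fst y) (snd y) * payoff k (fst y) (snd y))"
    and integral_Y_on_stage: "\<And>B. B \<in> sets (V k) \<Longrightarrow>
      (\<integral>x. indicator (stage k) x * (indicator B (incr {1..k} x, fst x) * Y x) \<partial>(P \<Otimes>\<^sub>M Ph))
      = (\<integral>y. indicator B y * (weight k (fst y) (snd y) * payoff k (fst y) (snd y)) \<partial>V k)"
proof -
  \<comment> \<open>Both claims come from the same application of Fubini; taking the whole space for
    \<open>B\<close> gives the first.\<close>
  have main: "integrable (V k) (\<lambda>y. indicator B y * (weight k (fst y) (snd y) * payoff k (fst y) (snd y))) \<and>
      (\<integral>x. indicator (stage k) x * (indicator B (incr {1..k} x, fst x) * Y x) \<partial>(P \<Otimes>\<^sub>M Ph))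
      = (\<integral>y. indicator B y * (weight k (fst y) (snd y) * payoff k (fst y) (snd y)) \<partial>V k)"
    if B [measurable]: "B \<in> sets (V k)" for B
  proof -
    note \<phi>_pos_tau_ext_measurable[OF k, measurable] stage_sets[OF k, measurable]
    define \<eta> where "\<eta> x = indicator B (fst x) * \<phi>_pos (tau_ext k (fst (fst x)) (snd x)) (snd (fst x))" for x
    have \<eta>: "\<eta> \<in> borel_measurable (V k \<Otimes>\<^sub>M PiM {k+1..N} (\<lambda>_. borel))"
      unfolding \<eta>_def[abs_def] by measurable
    have [measurable]: "(\<lambda>x. \<eta> ((incr {1..k} x, fst x), incr {k+1..N} x)) \<in> borel_measurable (P \<Otimes>\<^sub>M Ph)"
      by (rule measurable_compose[OF incr_split_measurable(1)[OF k] \<eta>])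
    have eq: "indicator (stage k) x * (indicator B (incr {1..k} x, fst x) * Y x)
        = indicator (stage k) x * \<eta> ((incr {1..k} x, fst x), incr {k+1..N} x)"
      if "x \<in> space (P \<Otimes>\<^sub>M Ph)" for x
      using Y_eq_tau_ext[OF k that] by (simp add: \<eta>_def)
    have "integrable (P \<Otimes>\<^sub>M Ph) (\<lambda>x. indicator (stage k) x * \<eta> ((incr {1..k} x, fst x), incr {k+1..N} x))"
    proof (rule Bochner_Integration.integrable_bound[OF Y_int _ AE_I2])
      fix x assume x: "x \<in> space (P \<Otimes>\<^sub>M Ph)"
      show "norm (indicator (stage k) x * \<eta> ((incr {1..k} x, fst x), incr {k+1..N} x)) \<le> norm (Y x)"
        unfolding eq[OF x, symmetric] by (auto simp: abs_mult split: split_indicator)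
    qed measurable
    then have int: "integrable (V k \<Otimes>\<^sub>M Ph) (\<lambda>z. weight k (fst (fst z)) (snd (fst z)) *
         (survives k (fst (fst z)) (incr {k+1..N} (snd (fst z), snd z)) * \<eta> (fst z, incr {k+1..N} (snd (fst z), snd z))))"
      unfolding integrable_on_stage[OF k \<eta>] .
    have inner: "(\<integral>\<omega>h. weight k (fst (fst (y, \<omega>h))) (snd (fst (y, \<omega>h))) *
         (survives k (fst (fst (y, \<omega>h))) (incr {k+1..N} (snd (fst (y, \<omega>h)), snd (y, \<omega>h))) *
          \<eta> (fst (y, \<omega>h), incr {k+1..N} (snd (fst (y, \<omega>h)), snd (y, \<omega>h)))) \<partial>Ph)
       = indicator B y * (weight k (fst y) (snd y) * payoff k (fst y) (snd y))" for y
    proof -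
      have "(\<integral>\<omega>h. weight k (fst y) (snd y) * (survives k (fst y) (incr {k+1..N} (snd y, \<omega>h)) *
          (indicator B y * \<phi>_pos (tau_ext k (fst y) (incr {k+1..N} (snd y, \<omega>h))) (snd y))) \<partial>Ph)
        = (\<integral>\<omega>h. (indicator B y * weight k (fst y) (snd y)) * (survives k (fst y) (incr {k+1..N} (snd y, \<omega>h)) *
          \<phi>_pos (tau_ext k (fst y) (incr {k+1..N} (snd y, \<omega>h))) (snd y)) \<partial>Ph)"
        by (intro Bochner_Integration.integral_cong) auto
      then show ?thesis by (simp add: \<eta>_def payoff_def)
    qed
    have "(\<integral>x. indicator (stage k) x * (indicator B (incr {1..k} x, fst x) * Y x) \<partial>(P \<Otimes>\<^sub>M Ph))
        = (\<integral>x. indicator (stage k) x * \<eta> ((incr {1..k} x, fst x), incr {k+1..N} x) \<partial>(P \<Otimes>\<^sub>M Ph))"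
      by (rule Bochner_Integration.integral_cong[OF refl eq])
    then show ?thesis
      using VPh.integrable_fst'[OF int] VPh.integral_fst'[OF int] integral_on_stage[OF k \<eta>]
      unfolding inner by simp
  qed
  show "integrable (V k) (\<lambda>y. weight k (fst y) (snd y) * payoff k (fst y) (snd y))"
    using conjunct1[OF main[OF sets.top]] by (subst Bochner_Integration.integrable_cong[OF refl]) auto
  show "\<And>B. B \<in> sets (V k) \<Longrightarrow>
      (\<integral>x. indicator (stage k) x * (indicator B (incr {1..k} x, fst x) * Y x) \<partial>(P \<Otimes>\<^sub>M Ph))
      = (\<integral>y. indicator B y * (weight k (fst y) (snd y) * payoff k (fst y) (snd y)) \<partial>V k)"
    using main by blast
qed

text \<open>For almost every frozen \<open>v\<close>, \<open>g_incr\<close> is a version of the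
  conditional payoff and the weight is \<open>F t\<close>-measurable up to a null set, so
  \<open>weighted_cond_exp\<close> applies on the section. Integrating over \<open>v\<close> gives
  the joint identity, with no joint choice of null sets.\<close>

lemma
  assumes k: "k \<le> N"
  shows integrable_weight_g_incr: "integrable (V k) (\<lambda>y. weight k (fst y) (snd y) * g_incr k (fst y) (snd y))"
    and integral_weight_g_incr: "\<And>B. B \<in> sets (U k \<Otimes>\<^sub>M F t) \<Longrightarrow>
      (\<integral>y. indicator B y * (weight k (fst y) (snd y) * g_incr k (fst y) (snd y)) \<partial>V k)
      = (\<integral>y. indicator B y * (weight k (fst y) (snd y) * payoff k (fst y) (snd y)) \<partial>V k)"
proof -
  define w where "w y = weight k (fst y) (snd y)" for y
  define p where "p y = payoff k (fst y) (snd y)" for y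
  define G where "G y = g_incr k (fst y) (snd y)" for y
  have [measurable]: "w \<in> borel_measurable (U k \<Otimes>\<^sub>M P)" "p \<in> borel_measurable (U k \<Otimes>\<^sub>M P)"
      "G \<in> borel_measurable (U k \<Otimes>\<^sub>M P)"
    using weight_measurable[OF k] payoff_measurable[OF k] g_incr_measurable[OF k]
    by (simp_all add: w_def[abs_def] p_def[abs_def] G_def[abs_def] V_def)
  have int_p: "integrable (U k \<Otimes>\<^sub>M P) (\<lambda>y. w y * p y)"
    using integrable_weight_payoff[OF k] by (simp add: w_def p_def V_def)
  have sec: "AE v in U k. integrable P (\<lambda>\<omega>. w (v, \<omega>) * G (v, \<omega>)) \<and>
      (\<integral>\<omega>. \<bar>w (v, \<omega>) * G (v, \<omega>)\<bar> \<partial>P) \<le> (\<integral>\<omega>. \<bar>w (v, \<omega>) * p (v, \<omega>)\<bar> \<partial>P) \<and>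
      (\<forall>C\<in>sets (F t). (\<integral>\<omega>. indicator C \<omega> * (w (v, \<omega>) * G (v, \<omega>)) \<partial>P)
        = (\<integral>\<omega>. indicator C \<omega> * (w (v, \<omega>) * p (v, \<omega>)) \<partial>P))"
    using AE_U_nonneg[of k] UP.AE_integrable_fst'[OF int_p] AE_space
  proof eventually_elim
    case (elim v)
    note [measurable] = \<open>v \<in> space (U k)\<close>
    have 1: "AE_measurable P (F t) (\<lambda>\<omega>. w (v, \<omega>))"
      using weight_AE_measurable[OF k elim(1)] by (simp add: w_def)
    have 2: "AE \<omega> in P. G (v, \<omega>) = real_cond_exp P (F t) (\<lambda>\<omega>. p (v, \<omega>)) \<omega>"
      using g_incr_version[OF k elim(1)] by (simp add: G_def p_def)
    show ?case
      using weighted_cond_exp[OF P_prob F_subalgebra[OF t_nonneg] 1 _ _ _ elim(2) 2] by auto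
  qed
  have int_G: "integrable (U k \<Otimes>\<^sub>M P) (\<lambda>y. w y * G y)"
  proof (rule UP.Fubini_integrable)
    show "AE v in U k. integrable P (\<lambda>\<omega>. w (v, \<omega>) * G (v, \<omega>))"
      using sec by eventually_elim simp
    \<comment> \<open>The sectionwise contraction bound supplies the dominating function, which is
      integrable by Fubini for the weighted payoff.\<close>
    show "integrable (U k) (\<lambda>v. \<integral>\<omega>. norm (w (v, \<omega>) * G (v, \<omega>)) \<partial>P)"
    proof (rule Bochner_Integration.integrable_bound)
      show "integrable (U k) (\<lambda>v. \<integral>\<omega>. \<bar>w (v, \<omega>) * p (v, \<omega>)\<bar> \<partial>P)"
        using UP.integrable_fst'[OF integrable_abs[OF int_p]] by simp
      show "AE v in U k. norm (\<integral>\<omega>. norm (w (v, \<omega>) * G (v, \<omega>)) \<partial>P)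
          \<le> norm (\<integral>\<omega>. \<bar>w (v, \<omega>) * p (v, \<omega>)\<bar> \<partial>P)"
        using sec
      proof eventually_elim
        case (elim v)
        have "0 \<le> (\<integral>\<omega>. \<bar>w (v, \<omega>) * G (v, \<omega>)\<bar> \<partial>P)" "0 \<le> (\<integral>\<omega>. \<bar>w (v, \<omega>) * p (v, \<omega>)\<bar> \<partial>P)"
          by (rule Bochner_Integration.integral_nonneg, simp)+
        then show ?case using elim by simp
      qed
    qed measurable
  qed measurable
  then show "integrable (V k) (\<lambda>y. weight k (fst y) (snd y) * g_incr k (fst y) (snd y))"
    by (simp add: w_def G_def V_def)
  fix B assume B: "B \<in> sets (U k \<Otimes>\<^sub>M F t)"
  then have [measurable]: "B \<in> sets (U k \<Otimes>\<^sub>M P)"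
    using subalgebra_pair_measure[OF F_subalgebra[OF t_nonneg], of "U k"] by (auto simp: subalgebra_def)
  have fub: "(\<integral>y. indicator B y * (w y * f y) \<partial>(U k \<Otimes>\<^sub>M P))
      = (\<integral>v. \<integral>\<omega>. indicator (Pair v -` B) \<omega> * (w (v, \<omega>) * f (v, \<omega>)) \<partial>P \<partial>U k)"
    if f: "integrable (U k \<Otimes>\<^sub>M P) (\<lambda>y. w y * f y)" for f
  proof -
    have "integrable (U k \<Otimes>\<^sub>M P) (\<lambda>y. indicator B y * (w y * f y))"
      using integrable_mult_indicator[OF _ f, of B] by simp
    from UP.integral_fst'[OF this, symmetric] show ?thesis
      by (simp add: indicator_vimage[symmetric] indicator_def)
  qed
  have "(\<integral>v. \<integral>\<omega>. indicator (Pair v -` B) \<omega> * (w (v, \<omega>) * G (v, \<omega>)) \<partial>P \<partial>U k)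
      = (\<integral>v. \<integral>\<omega>. indicator (Pair v -` B) \<omega> * (w (v, \<omega>) * p (v, \<omega>)) \<partial>P \<partial>U k)"
  proof (rule integral_cong_AE)
    have m: "(\<lambda>v. \<integral>\<omega>. indicator (Pair v -` B) \<omega> * f (v, \<omega>) \<partial>P) \<in> borel_measurable (U k)"
      if [measurable]: "f \<in> borel_measurable (U k \<Otimes>\<^sub>M P)" for f :: "_ \<Rightarrow> real"
    proof -
      have "(\<lambda>v. \<integral>\<omega>. indicator B (v, \<omega>) * f (v, \<omega>) \<partial>P) \<in> borel_measurable (U k)" by measurable
      then show ?thesis by (simp add: indicator_def)
    qed
    show "(\<lambda>v. \<integral>\<omega>. indicator (Pair v -` B) \<omega> * (w (v, \<omega>) * G (v, \<omega>)) \<partial>P) \<in> borel_measurable (U k)"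
      by (rule m[of "\<lambda>y. w y * G y"]) measurable
    show "(\<lambda>v. \<integral>\<omega>. indicator (Pair v -` B) \<omega> * (w (v, \<omega>) * p (v, \<omega>)) \<partial>P) \<in> borel_measurable (U k)"
      by (rule m[of "\<lambda>y. w y * p y"]) measurable
    show "AE v in U k. (\<integral>\<omega>. indicator (Pair v -` B) \<omega> * (w (v, \<omega>) * G (v, \<omega>)) \<partial>P)
        = (\<integral>\<omega>. indicator (Pair v -` B) \<omega> * (w (v, \<omega>) * p (v, \<omega>)) \<partial>P)"
      \<comment> \<open>The section of \<open>B\<close> at \<open>v\<close> belongs to
        \<open>F t\<close>, so the sectionwise identity may be tested on it.\<close>
      using sec by eventually_elim (use sets_Pair1[OF B] in blast)
  qed
  then show "(\<integral>y. indicator B y * (weight k (fst y) (snd y) * g_incr k (fst y) (snd y)) \<partial>V k)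
      = (\<integral>y. indicator B y * (weight k (fst y) (snd y) * payoff k (fst y) (snd y)) \<partial>V k)"
    using fub[OF int_G] fub[OF int_p] by (simp add: w_def G_def p_def V_def)
qed

lemma AE_V_snd:
  assumes "AE \<omega> in P. R \<omega>"
  shows "AE y in V k. R (snd y)"
proof -
  \<comment> \<open>The exceptional set of \<open>R\<close> is not assumed measurable, so it is
    enclosed in a measurable null set before passing to the product.\<close>
  obtain Z where Z: "{\<omega> \<in> space P. \<not> R \<omega>} \<subseteq> Z" "emeasure P Z = 0" and [measurable]: "Z \<in> sets P"
    using AE_E[OF assms] by blast
  have "AE \<omega> in P. \<omega> \<notin> Z" using Z(2) by (intro AE_not_in) (auto simp: null_sets_def)
  then have "AE y in U k \<Otimes>\<^sub>M P. snd y \<notin> Z"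
    by (intro UP.AE_pair_measure) (auto intro: AE_I2)
  then show ?thesis
    unfolding V_def using AE_space
    by eventually_elim (use Z(1) in \<open>auto simp: space_pair_measure\<close>)
qed

lemma survives_section_measurable:
  assumes k: "k \<le> N" and y: "y \<in> space (V k)"
  shows "(\<lambda>\<omega>h. survives k (fst y) (incr {k+1..N} (snd y, \<omega>h))) \<in> borel_measurable Ph"
proof -
  have "(\<lambda>z. survives k (fst (fst z)) (incr {k+1..N} (snd (fst z), snd z))) \<in> borel_measurable (V k \<Otimes>\<^sub>M Ph)"
    using measurable_compose[OF incr_split_measurable(2)[OF k] survives_measurable[OF k]] by simp
  from measurable_compose[OF measurable_Pair1'[OF y] this] show ?thesis by simp
qed

lemma integral_survives:
  assumes k: "k \<le> N" and y: "y \<in> space (V k)" and haz: "\<forall>n\<in>{1..N}. hazard_path (lam n) (snd y)"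
  shows "(\<integral>\<omega>h. survives k (fst y) (incr {k+1..N} (snd y, \<omega>h)) \<partial>Ph) = exp (- haz_exponent k (fst y) (snd y))"
proof (cases "k < N")
  case True
  then have n: "Suc k \<in> {1..N}" by auto
  interpret hazard_path "lam (Suc k)" "snd y" using haz n by blast
  have \<omega>: "snd y \<in> space P" using y by (auto simp: space_V)
  let ?s = "t - partial_sum (fst y) k"
  let ?A = "{\<omega>h \<in> space Ph. ?s < hit (lam (Suc k)) (E (Suc k) \<omega>h) (snd y)}"
  have h [measurable]: "(\<lambda>\<omega>h. hit (lam (Suc k)) (E (Suc k) \<omega>h) (snd y)) \<in> borel_measurable Ph"
    using \<omega> E_measurable[OF n] by (intro hit_measurable[OF n]) auto
  have "(\<integral>\<omega>h. survives k (fst y) (incr {k+1..N} (snd y, \<omega>h)) \<partial>Ph) = (\<integral>\<omega>h. indicator ?A \<omega>h \<partial>Ph)"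
    using True by (intro Bochner_Integration.integral_cong)
      (auto simp: survives_def incr_def ttau_eq_hit Suc_eq_plus1 split: split_indicator)
  also have "\<dots> = Ph.prob ?A" by simp
  also have "\<dots> = exp (- \<Lambda> ?s)"
    using hit_survival[OF Ph_prob E_exp[OF n] h, of ?s] by (simp add: measure_def)
  finally show ?thesis using True by (simp add: haz_exponent_def)
next
  case False
  then show ?thesis by (simp add: survives_def haz_exponent_def Ph.prob_space)
qed

text \<open>The value that the formula assigns on stage \<open>k\<close>, in waiting-time
  coordinates.\<close>

definition claim_value :: "nat \<Rightarrow> (nat \<Rightarrow> real) \<Rightarrow> 'a \<Rightarrow> real" where
  "claim_value k v \<omega> = exp (haz_exponent k v \<omega>) * g_incr k v \<omega>"

lemma claim_value_measurable: "k \<le> N \<Longrightarrow> (\<lambda>y. claim_value k (fst y) (snd y)) \<in> borel_measurable (V k)"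
  unfolding claim_value_def using haz_exponent_measurable[of k] g_incr_measurable[of k] by simp

lemma survives_nonneg: "0 \<le> survives k v z" and survives_le_1: "survives k v z \<le> 1"
  by (simp_all add: survives_def)

lemma
  assumes k: "k \<le> N" and B [measurable]: "B \<in> sets (V k)"
  shows integrable_claim_value_on_stage: "integrable (P \<Otimes>\<^sub>M Ph)
      (\<lambda>x. indicator (stage k) x * (indicator B (incr {1..k} x, fst x) * claim_value k (incr {1..k} x) (fst x)))"
    and integral_claim_value_on_stage:
      "(\<integral>x. indicator (stage k) x * (indicator B (incr {1..k} x, fst x) * claim_value k (incr {1..k} x) (fst x)) \<partial>(P \<Otimes>\<^sub>M Ph))
      = (\<integral>y. indicator B y * (weight k (fst y) (snd y) * g_incr k (fst y) (snd y)) \<partial>V k)"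
proof -
  note claim_value_measurable[OF k, measurable] weight_measurable[OF k, measurable] g_incr_measurable[OF k, measurable]
  define \<eta> where "\<eta> x = indicator B (fst x) * claim_value k (fst (fst x)) (snd (fst x))"
    for x :: "((nat \<Rightarrow> real) \<times> 'a) \<times> (nat \<Rightarrow> real)"
  have \<eta>: "\<eta> \<in> borel_measurable (V k \<Otimes>\<^sub>M PiM {k+1..N} (\<lambda>_. borel))"
    unfolding \<eta>_def[abs_def] by measurable
  define c where "c y = indicator B y * (weight k (fst y) (snd y) * g_incr k (fst y) (snd y))" for y
  define s where "s y \<omega>h = survives k (fst y) (incr {k+1..N} (snd y, \<omega>h))" for y \<omega>h
  define f where "f z = weight k (fst (fst z)) (snd (fst z)) * (s (fst z) (snd z) * (indicator B (fst z)
      * claim_value k (fst (fst z)) (snd (fst z))))" for z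
  have s_meas [measurable]: "(\<lambda>z. s (fst z) (snd z)) \<in> borel_measurable (V k \<Otimes>\<^sub>M Ph)"
    unfolding s_def
    using measurable_compose[OF incr_split_measurable(2)[OF k] survives_measurable[OF k]] by simp
  have f_meas: "f \<in> borel_measurable (V k \<Otimes>\<^sub>M Ph)"
    unfolding f_def[abs_def] by measurable
  have f_eq: "f (y, \<omega>h) = (exp (haz_exponent k (fst y) (snd y)) * c y) * s y \<omega>h" for y \<omega>h
    by (simp add: f_def c_def claim_value_def)
  have c_int: "integrable (V k) c"
    unfolding c_def[abs_def] using integrable_mult_indicator[OF B integrable_weight_g_incr[OF k]] by simp
  have int_s: "AE y in V k. integrable Ph (s y) \<and> (\<integral>\<omega>h. s y \<omega>h \<partial>Ph) = exp (- haz_exponent k (fst y) (snd y))"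
    using AE_V_snd[OF AE_hazard_path] AE_space
  proof eventually_elim
    case (elim y)
    have "integrable Ph (s y)"
      unfolding s_def[abs_def] using survives_section_measurable[OF k elim(2)]
      by (intro Ph.integrable_const_bound[of _ 1] AE_I2) (auto simp: survives_nonneg survives_le_1)
    then show ?case using integral_survives[OF k elim(2)] elim(1) by (simp add: s_def)
  qed
  have f_int: "integrable (V k \<Otimes>\<^sub>M Ph) f"
  proof (rule VPh.Fubini_integrable[OF f_meas])
    show "AE y in V k. integrable Ph (\<lambda>\<omega>h. f (y, \<omega>h))"
      using int_s by eventually_elim (simp add: f_eq)
    \<comment> \<open>The same cancellation holds for absolute values because \<open>s\<close> is
      nonnegative, so the growth of the exponential prefactor does not threaten
      integrability.\<close>
    have "AE y in V k. \<bar>c y\<bar> = (\<integral>\<omega>h. norm (f (y, \<omega>h)) \<partial>Ph)"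
      using int_s
    proof eventually_elim
      case (elim y)
      have "norm (f (y, \<omega>h)) = (exp (haz_exponent k (fst y) (snd y)) * \<bar>c y\<bar>) * s y \<omega>h" for \<omega>h
        by (simp add: f_eq abs_mult s_def survives_nonneg)
      then show ?case using elim by (simp add: exp_minus)
    qed
    then show "integrable (V k) (\<lambda>y. \<integral>\<omega>h. norm (f (y, \<omega>h)) \<partial>Ph)"
      using f_meas by (intro integrable_cong_AE_imp[OF integrable_abs[OF c_int]]) auto
  qed
  have "(\<integral>z. f z \<partial>(V k \<Otimes>\<^sub>M Ph)) = (\<integral>y. \<integral>\<omega>h. f (y, \<omega>h) \<partial>Ph \<partial>V k)"
    by (rule VPh.integral_fst'[OF f_int, symmetric])
  also have "\<dots> = (\<integral>y. c y \<partial>V k)"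
  proof (rule integral_cong_AE)
    show "AE y in V k. (\<integral>\<omega>h. f (y, \<omega>h) \<partial>Ph) = c y"
      using int_s by eventually_elim (simp add: f_eq exp_minus)
  qed (use f_meas c_int in auto)
  finally have f_integral: "(\<integral>z. f z \<partial>(V k \<Otimes>\<^sub>M Ph)) = (\<integral>y. c y \<partial>V k)" .
  show "integrable (P \<Otimes>\<^sub>M Ph)
      (\<lambda>x. indicator (stage k) x * (indicator B (incr {1..k} x, fst x) * claim_value k (incr {1..k} x) (fst x)))"
    using integrable_on_stage[OF k \<eta>] f_int by (simp add: \<eta>_def f_def[abs_def] s_def)
  show "(\<integral>x. indicator (stage k) x * (indicator B (incr {1..k} x, fst x) * claim_value k (incr {1..k} x) (fst x)) \<partial>(P \<Otimes>\<^sub>M Ph))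
      = (\<integral>y. indicator B y * (weight k (fst y) (snd y) * g_incr k (fst y) (snd y)) \<partial>V k)"
    using integral_on_stage[OF k \<eta>] f_integral by (simp add: \<eta>_def f_def s_def c_def)
qed

section \<open>The enlarged filtration and its trace on a stage\<close>

abbreviation Q :: "('a \<times> 'b) measure" where "Q \<equiv> GN P Ph F lam E N t"

definition gens :: "('a \<times> 'b) set set" where
  "gens = {A \<times> space Ph | A. A \<in> sets (F t)} \<union>
   {{x \<in> space P \<times> space Ph. tau lam E n x \<le> s} | n s. n \<in> {1..N} \<and> 0 \<le> s \<and> s \<le> t}"

lemma gens_subset: "gens \<subseteq> sets (P \<Otimes>\<^sub>M Ph)"
proof
  fix X assume "X \<in> gens"
  then consider (F) A where "X = A \<times> space Ph" "A \<in> sets (F t)"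
    | (H) n s where "X = {x \<in> space P \<times> space Ph. tau lam E n x \<le> s}" "n \<in> {1..N}"
    unfolding gens_def by blast
  then show "X \<in> sets (P \<Otimes>\<^sub>M Ph)"
  proof cases
    case F
    then show ?thesis using F_sub[OF t_nonneg] by auto
  next
    case H
    then have [measurable]: "tau lam E n \<in> borel_measurable (P \<Otimes>\<^sub>M Ph)" by (intro tau_measurable) auto
    have "{x \<in> space (P \<Otimes>\<^sub>M Ph). tau lam E n x \<le> s} \<in> sets (P \<Otimes>\<^sub>M Ph)" by measurable
    then show ?thesis using H by (simp add: space_pair_measure)
  qed
qed

lemma gens_Pow: "gens \<subseteq> Pow (space P \<times> space Ph)"
  using order_trans[OF gens_subset sets.space_closed] by (simp only: space_pair_measure)

lemma space_GN: "space Q = space (P \<Otimes>\<^sub>M Ph)"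
  unfolding GN_def gens_def[symmetric] space_measure_of[OF gens_Pow] space_pair_measure ..

lemma sets_GN: "sets Q = sigma_sets (space P \<times> space Ph) gens"
  unfolding GN_def gens_def[symmetric] by (rule sets_measure_of[OF gens_Pow])

lemma GN_subalgebra: "subalgebra (P \<Otimes>\<^sub>M Ph) Q"
  unfolding subalgebra_def space_GN sets_GN
  using sets.sigma_sets_subset[OF gens_subset] by (simp only: space_pair_measure)

lemma GN_F: "A \<in> sets (F t) \<Longrightarrow> A \<times> space Ph \<in> sets Q"
  unfolding sets_GN gens_def by (rule sigma_sets.Basic) blast

lemma GN_tau: "n \<in> {1..N} \<Longrightarrow> 0 \<le> s \<Longrightarrow> s \<le> t \<Longrightarrow> {x \<in> space Q. tau lam E n x \<le> s} \<in> sets Q"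
  unfolding space_GN space_pair_measure sets_GN gens_def by (rule sigma_sets.Basic) blast

lemma tau_mono: "k \<le> l \<Longrightarrow> tau lam E k x \<le> tau lam E l x"
  using tau_split[of k l x] by (simp add: sum_nonneg ttau_nonneg)

lemma fst_GN [measurable]: "fst \<in> Q \<rightarrow>\<^sub>M F t"
proof (rule measurableI)
  fix x assume "x \<in> space Q"
  then have "x \<in> space P \<times> space Ph" unfolding space_GN space_pair_measure .
  then have "fst x \<in> space P" by (rule SigmaE) simp
  then show "fst x \<in> space (F t)" unfolding F_space[OF t_nonneg] .
next
  fix A assume A: "A \<in> sets (F t)"
  then have "A \<subseteq> space P" using F_sub[OF t_nonneg] sets.sets_into_space[of A P] by blast
  then have "fst -` A \<inter> space Q = A \<times> space Ph"
    unfolding space_GN space_pair_measure by auto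
  then show "fst -` A \<inter> space Q \<in> sets Q" using GN_F[OF A] by simp
qed

text \<open>By time \<open>t\<close> a default time is observed only up to \<open>t\<close>; the
  generators determine the stopped time, not the default time itself.\<close>

lemma min_tau_GN:
  assumes "n \<le> N"
  shows "(\<lambda>x. min (tau lam E n x) t) \<in> borel_measurable Q"
proof (cases "n = 0")
  case True
  then show ?thesis by (simp add: tau_def)
next
  case False
  show ?thesis
  proof (rule borel_measurableI_le)
    fix a :: real
    consider "t \<le> a" | "a < 0" | "0 \<le> a" "a < t" by linarith
    then show "{x \<in> space Q. min (tau lam E n x) t \<le> a} \<in> sets Q"
    proof cases
      case 1
      then have "{x \<in> space Q. min (tau lam E n x) t \<le> a} = space Q" by auto
      then show ?thesis by simp
    next
      case 2
      then have "{x \<in> space Q. min (tau lam E n x) t \<le> a} = {}"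
        using tau_nonneg[of n] t_nonneg by (auto simp: min_le_iff_disj not_le intro: less_le_trans)
      then show ?thesis by (simp only: sets.empty_sets)
    next
      case 3
      then have "{x \<in> space Q. min (tau lam E n x) t \<le> a} = {x \<in> space Q. tau lam E n x \<le> a}" by auto
      then show ?thesis using GN_tau[of n a] 3 False assms by auto
    qed
  qed
qed

lemma stage_GN:
  assumes k: "k \<le> N"
  shows "stage k \<in> sets Q"
proof -
  have le: "{x \<in> space Q. tau lam E n x \<le> t} \<in> sets Q" if "n \<le> N" for n
  proof (cases "n = 0")
    case True
    then show ?thesis using t_nonneg by (simp add: tau_def)
  next
    case False
    then show ?thesis using GN_tau[of n t] t_nonneg that by auto
  qed
  show ?thesis
  proof (cases "k < N")
    case True
    then have "stage k = {x \<in> space Q. tau lam E k x \<le> t} - {x \<in> space Q. tau lam E (Suc k) x \<le> t}"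
      by (auto simp: stage_def space_GN)
    then show ?thesis using le[of k] le[of "Suc k"] True by auto
  next
    case False
    then have "stage k = {x \<in> space Q. tau lam E k x \<le> t}" by (auto simp: stage_def space_GN)
    then show ?thesis using le[OF k] by simp
  qed
qed

lemma incr_space: "x \<in> space (P \<Otimes>\<^sub>M Ph) \<Longrightarrow> (incr {1..k} x, fst x) \<in> space (U k \<Otimes>\<^sub>M F t)"
  unfolding space_pair_measure space_PiM F_space[OF t_nonneg]
  by (intro SigmaI) (auto simp: incr_def)

lemma GN_trace:
  assumes k: "k \<le> N" and A: "A \<in> sets Q"
  shows "\<exists>B\<in>sets (U k \<Otimes>\<^sub>M F t). \<forall>x\<in>stage k. x \<in> A \<longleftrightarrow> (incr {1..k} x, fst x) \<in> B"
  using A unfolding sets_GN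
proof (induction rule: sigma_sets.induct)
  case (Basic X)
  then consider (F) C where "X = C \<times> space Ph" "C \<in> sets (F t)"
    | (H) n s where "X = {x \<in> space P \<times> space Ph. tau lam E n x \<le> s}" "n \<in> {1..N}" "0 \<le> s" "s \<le> t"
    unfolding gens_def by blast
  then show ?case
  proof cases
    case F
    have "\<forall>x\<in>stage k. x \<in> X \<longleftrightarrow> (incr {1..k} x, fst x) \<in> space (U k) \<times> C"
      by (auto simp: F(1) stage_def space_pair_measure space_PiM incr_def)
    then show ?thesis using F(2) by (intro bexI[of _ "space (U k) \<times> C"]) auto
  next
    case H
    show ?thesis
    proof (cases "n \<le> k")
      case True
      have [measurable]: "(\<lambda>y. partial_sum (fst y) n) \<in> borel_measurable (U k \<Otimes>\<^sub>M F t)"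
        using partial_sum_measurable[OF True, of "F t"] by (simp cong: measurable_cong_sets sets_pair_measure_cong add: sets_U)
      have "\<forall>x\<in>stage k. x \<in> X \<longleftrightarrow> (incr {1..k} x, fst x) \<in> {y \<in> space (U k \<Otimes>\<^sub>M F t). partial_sum (fst y) n \<le> s}"
        using incr_space by (auto simp: H(1) stage_def partial_sum_incr[OF True]) (auto simp: space_pair_measure)
      then show ?thesis by (intro bexI[of _ "{y \<in> space (U k \<Otimes>\<^sub>M F t). partial_sum (fst y) n \<le> s}"]) auto
    next
      case False
      then have "k < N" "Suc k \<le> n" using H(2) by auto
      then have "x \<notin> X" if "x \<in> stage k" for x
        using that tau_mono[OF \<open>Suc k \<le> n\<close>, of x] H(4) by (auto simp: H(1) stage_def)
      then show ?thesis by (intro bexI[of _ "{}"]) auto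
    qed
  qed
next
  case Empty
  then show ?case by (intro bexI[of _ "{}"]) auto
next
  case (Compl X)
  then obtain B where B: "B \<in> sets (U k \<Otimes>\<^sub>M F t)" "\<forall>x\<in>stage k. x \<in> X \<longleftrightarrow> (incr {1..k} x, fst x) \<in> B" by blast
  have "\<forall>x\<in>stage k. x \<in> space P \<times> space Ph - X \<longleftrightarrow> (incr {1..k} x, fst x) \<in> space (U k \<Otimes>\<^sub>M F t) - B"
    using B(2) incr_space by (auto simp: stage_def) (auto simp: space_pair_measure)
  then show ?case using B(1) by (intro bexI[of _ "space (U k \<Otimes>\<^sub>M F t) - B"]) auto
next
  case (Union X)
  then have "\<forall>i. \<exists>B. B \<in> sets (U k \<Otimes>\<^sub>M F t) \<and> (\<forall>x\<in>stage k. x \<in> X i \<longleftrightarrow> (incr {1..k} x, fst x) \<in> B)" by blast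
  then obtain B where B: "\<And>i. B i \<in> sets (U k \<Otimes>\<^sub>M F t)"
      "\<And>i. \<forall>x\<in>stage k. x \<in> X i \<longleftrightarrow> (incr {1..k} x, fst x) \<in> B i" by metis
  then show ?case by (intro bexI[of _ "\<Union>i. B i"]) auto
qed

lemma GN_lift:
  assumes k: "k \<le> N" and h: "h \<in> borel_measurable (U k \<Otimes>\<^sub>M F t)"
  shows "(\<lambda>x. indicator (stage k) x * h (incr {1..k} x, fst x) :: real) \<in> borel_measurable Q"
proof -
  \<comment> \<open>Increments of the stopped default times are observable everywhere and coincide
    with the true waiting times on the stage, where all the default times involved are at most
    \<open>t\<close>.\<close>
  define T where "T x = (\<lambda>j\<in>{1..k}. min (tau lam E j x) t - min (tau lam E (j - 1) x) t)" for x
  have "T \<in> Q \<rightarrow>\<^sub>M PiM {1..k} (\<lambda>_. borel)"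
    unfolding T_def[abs_def] using k
    by (intro measurable_restrict borel_measurable_diff min_tau_GN) auto
  then have [measurable]: "T \<in> Q \<rightarrow>\<^sub>M U k"
    by (simp cong: measurable_cong_sets add: sets_U)
  have T_D: "T x = incr {1..k} x" if "x \<in> stage k" for x
    unfolding T_def incr_def
  proof (rule restrict_ext)
    fix j assume j: "j \<in> {1..k}"
    have "j - 1 \<le> k" "j \<le> k" using j by auto
    then have "tau lam E j x \<le> t" "tau lam E (j - 1) x \<le> t"
      using that tau_mono[of j k x] tau_mono[of "j - 1" k x] by (auto simp: stage_def)
    moreover have "tau lam E j x = tau lam E (j - 1) x + ttau lam E j x"
      using tau_split[of "j - 1" j x] j by simp
    ultimately show "min (tau lam E j x) t - min (tau lam E (j - 1) x) t = ttau lam E j x" by simp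
  qed
  note h [measurable] stage_GN[OF k, measurable]
  have "(\<lambda>x. h (T x, fst x)) \<in> borel_measurable Q"
    by (rule measurable_compose[OF _ h]) measurable
  then have "(\<lambda>x. indicator (stage k) x * h (T x, fst x)) \<in> borel_measurable Q" by measurable
  moreover have "indicator (stage k) x * h (T x, fst x) = indicator (stage k) x * h (incr {1..k} x, fst x)" for x
    using T_D[of x] by (auto split: split_indicator)
  ultimately show ?thesis by simp
qed

text \<open>The cut-off keeps the hazard horizon \<open>t - partial_sum v k\<close> between 0 and
  \<open>t\<close>, and each \<open>g_incr k v\<close> agrees almost surely with a conditional
  expectation given \<open>F t\<close>. \<open>AE_measurable_pair\<close> then turns these separate
  sections into one jointly measurable representative.\<close>

lemma claim_value_AE_measurable:
  assumes k: "k \<le> N"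
  shows "AE_measurable (V k) (U k \<Otimes>\<^sub>M F t) (\<lambda>y. if partial_sum (fst y) k \<le> t then claim_value k (fst y) (snd y) else 0)"
  unfolding V_def
proof (rule AE_measurable_pair[OF prob_space_U P_prob F_subalgebra[OF t_nonneg]])
  note claim_value_measurable[OF k, measurable] partial_sum_measurable_V[of k k, measurable]
  show "(\<lambda>y. if partial_sum (fst y) k \<le> t then claim_value k (fst y) (snd y) else 0) \<in> borel_measurable (U k \<Otimes>\<^sub>M P)"
    unfolding V_def[symmetric] by measurable
  show "AE v in U k. AE_measurable P (F t) (\<lambda>\<omega>. if partial_sum (fst (v, \<omega>)) k \<le> t
      then claim_value k (fst (v, \<omega>)) (snd (v, \<omega>)) else 0)"
    using AE_U_nonneg[of k]
  proof eventually_elim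
    case (elim v)
    show ?case
    proof (cases "partial_sum v k \<le> t")
      case True
      have "AE_measurable P (F t) (\<lambda>\<omega>. exp (haz_exponent k v \<omega>))"
      proof (cases "k < N")
        case kN: True
        have "AE_measurable P (F (t - partial_sum v k)) (\<lambda>\<omega>. enn2real (cumhaz (lam (Suc k)) (t - partial_sum v k) \<omega>))"
          by (rule cumhaz_AE_measurable) (use kN True in auto)
        then have "AE_measurable P (F t) (\<lambda>\<omega>. enn2real (cumhaz (lam (Suc k)) (t - partial_sum v k) \<omega>))"
          by (rule AE_measurable_mono) (use True partial_sum_nonneg[OF elim, of k] in auto)
        then show ?thesis
          using AE_measurable_compose[of P "F t" _ exp] kN by (simp add: haz_exponent_def)
      next
        case False
        then show ?thesis by (intro AE_measurableI[of "\<lambda>_. 1"]) (auto simp: haz_exponent_def)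
      qed
      moreover have "AE_measurable P (F t) (g_incr k v)"
        by (rule AE_measurableI[OF borel_measurable_cond_exp g_incr_version[OF k elim]])
      ultimately have "AE_measurable P (F t) (\<lambda>\<omega>. exp (haz_exponent k v \<omega>) * g_incr k v \<omega>)"
        by (rule AE_measurable_mult)
      then show ?thesis using True by (simp add: claim_value_def)
    next
      case False
      then show ?thesis by (intro AE_measurableI[of "\<lambda>_. 0"]) auto
    qed
  qed
qed

text \<open>The defining property of conditional expectation is checked on the stage for an
  observable representative \<open>h\<close> of \<open>claim_value\<close>, testing events only
  through their traces.\<close>

lemma cond_exp_on_stage:
  assumes k: "k \<le> N"
  shows "AE x in P \<Otimes>\<^sub>M Ph. x \<in> stage k \<longrightarrow>
    real_cond_exp (P \<Otimes>\<^sub>M Ph) Q Y x = claim_value k (incr {1..k} x) (fst x)"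
proof -
  let ?M = "P \<Otimes>\<^sub>M Ph"
  interpret Q: finite_measure_subalgebra ?M Q by standard (rule GN_subalgebra)
  let ?\<Theta> = "\<lambda>x. (incr {1..k} x, fst x)"
  note stage_sets[OF k, measurable] stage_GN[OF k, measurable] claim_value_measurable[OF k, measurable]
    partial_sum_measurable_V[of k k, measurable]
  have DV: "B \<in> sets (V k)" if "B \<in> sets (U k \<Otimes>\<^sub>M F t)" for B
    using that subalgebra_pair_measure[OF F_subalgebra[OF t_nonneg], of "U k"]
    by (auto simp: subalgebra_def V_def)
  obtain h where hF: "h \<in> borel_measurable (U k \<Otimes>\<^sub>M F t)"
    and h: "AE y in V k. (if partial_sum (fst y) k \<le> t then claim_value k (fst y) (snd y) else 0) = h y"
    using claim_value_AE_measurable[OF k] by (auto simp: AE_measurable_def)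
  have [measurable]: "h \<in> borel_measurable (V k)"
    unfolding V_def by (rule measurable_from_subalg[OF subalgebra_pair_measure[OF F_subalgebra[OF t_nonneg]] hF])
  \<comment> \<open>The representative agrees with \<open>claim_value\<close> for almost all frozen
    values; absolute continuity carries this over to the true waiting times.\<close>
  have "AE x in ?M. (if partial_sum (fst (?\<Theta> x)) k \<le> t then claim_value k (fst (?\<Theta> x)) (snd (?\<Theta> x)) else 0) = h (?\<Theta> x)"
    by (rule AE_incr[OF k h]) measurable
  then have hD: "AE x in ?M. indicator (stage k) x * claim_value k (incr {1..k} x) (fst x) = indicator (stage k) x * h (?\<Theta> x)"
    by eventually_elim (auto simp: stage_def partial_sum_incr split: split_indicator)
  have lift: "(\<lambda>x. indicator (stage k) x * h (?\<Theta> x)) \<in> borel_measurable Q"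
    by (rule GN_lift[OF k hF])
  note measurable_from_subalg[OF GN_subalgebra lift, measurable]
  have \<Theta> [measurable]: "?\<Theta> \<in> ?M \<rightarrow>\<^sub>M V k"
    using measurable_compose[OF incr_split_measurable(1)[OF k] measurable_fst] by simp
  have int_hh: "integrable ?M (\<lambda>x. indicator (stage k) x * claim_value k (incr {1..k} x) (fst x))"
    using integrable_claim_value_on_stage[OF k sets.top]
    by (rule Bochner_Integration.integrable_cong[THEN iffD1, rotated 2])
       (use measurable_space[OF \<Theta>] in auto)
  have int_h: "integrable ?M (\<lambda>x. indicator (stage k) x * h (?\<Theta> x))"
    using int_hh by (rule integrable_cong_AE_imp) (use hD in auto)
  have int_Y: "integrable ?M (\<lambda>x. indicator (stage k) x * Y x)"
    using integrable_mult_indicator[OF stage_sets[OF k] Y_int] by simp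
  have [measurable]: "Y \<in> borel_measurable ?M" using Y_int by simp
  have "AE x in ?M. real_cond_exp ?M Q (\<lambda>x. indicator (stage k) x * Y x) x = indicator (stage k) x * h (?\<Theta> x)"
  proof (rule Q.real_cond_exp_charact[OF _ int_Y int_h lift])
    fix A assume A: "A \<in> sets Q"
    then have [measurable]: "A \<in> sets ?M" using GN_subalgebra by (auto simp: subalgebra_def)
    obtain B where B: "B \<in> sets (U k \<Otimes>\<^sub>M F t)" "\<And>x. x \<in> stage k \<Longrightarrow> x \<in> A \<longleftrightarrow> ?\<Theta> x \<in> B"
      using GN_trace[OF k A] by blast
    note [measurable] = DV[OF B(1)]
    have AB: "indicator A x * (indicator (stage k) x * c) = indicator (stage k) x * (indicator B (?\<Theta> x) * c)" for x and c :: real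
      using B(2)[of x] by (auto split: split_indicator)
    \<comment> \<open>The event \<open>A\<close> is replaced by its trace \<open>B\<close>, the
      payoff by its version under the weight, and finally the cancelled survival factor is put
      back.\<close>
    have "(\<integral>x\<in>A. indicator (stage k) x * Y x \<partial>?M) = (\<integral>x. indicator (stage k) x * (indicator B (?\<Theta> x) * Y x) \<partial>?M)"
      unfolding set_lebesgue_integral_def by (simp add: AB)
    also have "\<dots> = (\<integral>y. indicator B y * (weight k (fst y) (snd y) * g_incr k (fst y) (snd y)) \<partial>V k)"
      using integral_Y_on_stage[OF k DV[OF B(1)]] integral_weight_g_incr[OF k B(1)] by simp
    also have "\<dots> = (\<integral>x. indicator (stage k) x * (indicator B (?\<Theta> x) * claim_value k (incr {1..k} x) (fst x)) \<partial>?M)"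
      by (rule integral_claim_value_on_stage[OF k DV[OF B(1)], symmetric])
    also have "\<dots> = (\<integral>x. indicator A x * (indicator (stage k) x * claim_value k (incr {1..k} x) (fst x)) \<partial>?M)"
      by (simp add: AB)
    also have "\<dots> = (\<integral>x. indicator A x * (indicator (stage k) x * h (?\<Theta> x)) \<partial>?M)"
      by (rule integral_cong_AE) (use hD int_hh in auto)
    finally show "(\<integral>x\<in>A. indicator (stage k) x * Y x \<partial>?M) = (\<integral>x\<in>A. indicator (stage k) x * h (?\<Theta> x) \<partial>?M)"
      unfolding set_lebesgue_integral_def by simp
  qed
  \<comment> \<open>The stage is itself observable at \<open>t\<close>, so its indicator leaves the
    conditional expectation.\<close>
  moreover have "AE x in ?M. real_cond_exp ?M Q (\<lambda>x. indicator (stage k) x * Y x) x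
      = indicator (stage k) x * real_cond_exp ?M Q Y x"
    by (rule Q.real_cond_exp_mult) (use int_Y in auto)
  ultimately show ?thesis using hD
    by eventually_elim (auto split: split_indicator_asm)
qed

text \<open>Finitely many stage identities hold simultaneously almost surely. Since the default
  times are ordered, exactly one indicator on the right-hand side is nonzero at each point.\<close>

theorem cond_exp_formula:
  "AE x in (P \<Otimes>\<^sub>M Ph).
     real_cond_exp (P \<Otimes>\<^sub>M Ph) Q Y x =
       (if t < tau lam E 1 x then 1 else 0) * exp (enn2real (cumhaz (lam 1) t (fst x)))
         * real_cond_exp P (F t)
             (\<lambda>\<omega>. \<integral>\<omega>h. (if t < tau lam E 1 (\<omega>, \<omega>h) then 1 else 0) * Y (\<omega>, \<omega>h) \<partial>Ph) (fst x)
     + (\<Sum>k=1..N-1. (if tau lam E k x \<le> t \<and> t < tau lam E (Suc k) x then 1 else 0)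
           * exp (enn2real (cumhaz (lam (Suc k)) (t - tau lam E k x) (fst x)))
           * g k (tauvec lam E k x) (fst x))
     + (if tau lam E N x \<le> t then 1 else 0) * g N (tauvec lam E N x) (fst x)"
proof -
  have "AE x in P \<Otimes>\<^sub>M Ph. \<forall>k\<in>{0..N}. x \<in> stage k \<longrightarrow>
      real_cond_exp (P \<Otimes>\<^sub>M Ph) Q Y x = claim_value k (incr {1..k} x) (fst x)"
    by (rule AE_finite_allI) (auto intro!: cond_exp_on_stage)
  then show ?thesis using AE_space
  proof eventually_elim
    case (elim x)
    \<comment> \<open>The number of defaults up to \<open>t\<close>. The maximum exists because
      index 0 always qualifies: the empty sum is 0 and \<open>t\<close> is nonnegative.\<close>
    define m where "m = Max {k\<in>{0..N}. tau lam E k x \<le> t}"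
    have "0 \<in> {k\<in>{0..N}. tau lam E k x \<le> t}" using t_nonneg by (simp add: tau_def)
    then have "m \<in> {k\<in>{0..N}. tau lam E k x \<le> t}" unfolding m_def by (intro Max_in) auto
    then have m: "m \<le> N" "tau lam E m x \<le> t" by auto
    have "l \<le> m" if "l \<le> N" "tau lam E l x \<le> t" for l
      unfolding m_def by (rule Max_ge) (use that in auto)
    then have iff: "tau lam E l x \<le> t \<longleftrightarrow> l \<le> m" if "l \<le> N" for l
      using that tau_mono[of l m x] m(2) by auto
    have tv: "(\<lambda>l\<in>{1..k}. partial_sum (incr {1..k} x) l) = tauvec lam E k x" for k
      unfolding tauvec_def by (rule restrict_ext) (simp add: partial_sum_incr)
    have "x \<in> stage m" using m iff[of "Suc m"] elim(2) by (auto simp: stage_def not_le[symmetric])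
    then have cond: "real_cond_exp (P \<Otimes>\<^sub>M Ph) Q Y x = claim_value m (incr {1..m} x) (fst x)"
      using elim(1) m(1) by auto
    have i0: "t < tau lam E 1 x \<longleftrightarrow> m = 0" using iff[of 1] N_pos by (auto simp: not_le[symmetric])
    have ik: "tau lam E k x \<le> t \<and> t < tau lam E (Suc k) x \<longleftrightarrow> k = m" if "k \<in> {1..N-1}" for k
    proof -
      have "1 \<le> k" "k \<le> N - 1" using that by auto
      then have "k \<le> N" "Suc k \<le> N" using N_pos by arith+
      then show ?thesis using iff[of k] iff[of "Suc k"] by (simp add: not_le[symmetric]) arith
    qed
    have iN: "tau lam E N x \<le> t \<longleftrightarrow> m = N" using iff[of N] m(1) by (metis le_antisym order_refl)
    have sum: "(\<Sum>k=1..N-1. (if tau lam E k x \<le> t \<and> t < tau lam E (Suc k) x then 1 else 0)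
           * exp (enn2real (cumhaz (lam (Suc k)) (t - tau lam E k x) (fst x)))
           * g k (tauvec lam E k x) (fst x))
        = (if m \<in> {1..N-1} then exp (enn2real (cumhaz (lam (Suc m)) (t - tau lam E m x) (fst x)))
           * g m (tauvec lam E m x) (fst x) else 0)" (is "?L = ?R")
    proof -
      have "?L = (\<Sum>k=1..N-1. if k = m then exp (enn2real (cumhaz (lam (Suc k)) (t - tau lam E k x) (fst x)))
           * g k (tauvec lam E k x) (fst x) else 0)"
        by (intro sum.cong refl) (simp add: ik)
      also have "\<dots> = ?R" by simp
      finally show ?thesis .
    qed
    consider "m = 0" | "m \<in> {1..N-1}" | "m = N" "0 < m" using m(1) unfolding atLeastAtMost_iff by arith
    then show ?case
    proof cases
      case 1
      then show ?thesis
        unfolding cond sum i0 iN using N_pos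
        by (simp add: claim_value_def haz_exponent_def g_incr_def partial_sum_def Suc_eq_plus1)
    next
      case 2
      then have "0 < m" "m < N" by auto
      then show ?thesis
        unfolding cond sum i0 iN using 2 by (simp add: claim_value_def haz_exponent_def g_incr_def tv partial_sum_incr)
    next
      case 3
      then show ?thesis
        unfolding cond sum i0 iN by (simp add: claim_value_def haz_exponent_def g_incr_def tv)
    qed
  qed
qed

end

theorem mainTheorem7:
  fixes P :: "'a::polish_space measure" and Ph :: "'b::polish_space measure"
    and F :: "real \<Rightarrow> 'a measure"
    and N :: nat
    and E :: "nat \<Rightarrow> 'b \<Rightarrow> real"
    and lam :: "nat \<Rightarrow> real \<Rightarrow> 'a \<Rightarrow> real"
    and t :: real
    and Y :: "'a \<times> 'b \<Rightarrow> real"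
    and \<phi> :: "(nat \<Rightarrow> real) \<Rightarrow> 'a \<Rightarrow> real"
    and g :: "nat \<Rightarrow> (nat \<Rightarrow> real) \<Rightarrow> 'a \<Rightarrow> real"
  assumes P_prob: "prob_space P" and P_borel: "sets P = sets borel"
    and Ph_prob: "prob_space Ph" and Ph_borel: "sets Ph = sets borel"
    and F_space: "\<And>s. 0 \<le> s \<Longrightarrow> space (F s) = space P"
    and F_sub: "\<And>s. 0 \<le> s \<Longrightarrow> sets (F s) \<subseteq> sets P"
    and F_mono: "\<And>s r. 0 \<le> s \<Longrightarrow> s \<le> r \<Longrightarrow> sets (F s) \<subseteq> sets (F r)"
    and N_pos: "1 \<le> N"
    and E_indep: "prob_space.indep_vars Ph (\<lambda>_. borel) E {1..N}"
    and E_exp: "\<And>n. n \<in> {1..N} \<Longrightarrow> distributed Ph lborel (E n) (exponential_density 1)"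
    and lam_meas: "\<And>n. n \<in> {1..N} \<Longrightarrow>
        (\<lambda>(s, \<omega>). lam n s \<omega>) \<in> borel_measurable (restrict_space borel {0..} \<Otimes>\<^sub>M P)"
    and lam_adapted: "\<And>n s. n \<in> {1..N} \<Longrightarrow> 0 \<le> s \<Longrightarrow> lam n s \<in> borel_measurable (F s)"
    and lam_nonneg: "\<And>n s \<omega>. n \<in> {1..N} \<Longrightarrow> 0 \<le> s \<Longrightarrow> \<omega> \<in> space P \<Longrightarrow> 0 \<le> lam n s \<omega>"
    and lam_fin: "\<And>n. n \<in> {1..N} \<Longrightarrow> AE \<omega> in P. \<forall>r\<ge>0. cumhaz (lam n) r \<omega> < \<infinity>"
    and lam_inf: "\<And>n. n \<in> {1..N} \<Longrightarrow>
        AE \<omega> in P. (\<integral>\<^sup>+ s. indicator {0..} s * ennreal (lam n s \<omega>) \<partial>lborel) = \<infinity>"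
    and t_nonneg: "0 \<le> t"
    and Y_int: "integrable (P \<Otimes>\<^sub>M Ph) Y"
    and \<phi>_meas: "(\<lambda>(u, \<omega>). \<phi> u \<omega>) \<in>
        borel_measurable (PiM {1..N} (\<lambda>_. restrict_space borel {0..}) \<Otimes>\<^sub>M Finf P F)"
    and Y_eq: "\<And>x. x \<in> space (P \<Otimes>\<^sub>M Ph) \<Longrightarrow> Y x = \<phi> (tauvec lam E N x) (fst x)"
    and g_meas: "\<And>k. k \<in> {1..N} \<Longrightarrow>
        (\<lambda>(u, \<omega>). g k u \<omega>) \<in> borel_measurable (PiM {1..k} (\<lambda>_. borel) \<Otimes>\<^sub>M P)"
    and g_version: "\<And>k u. k \<in> {1..N} \<Longrightarrow> u \<in> (\<Pi>\<^sub>E i\<in>{1..k}. {0..}) \<Longrightarrow>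
        AE \<omega> in P. g k u \<omega> = real_cond_exp P (F t)
          (\<lambda>\<omega>'. if k < N
                 then (\<integral>\<omega>h. (if t - u k < ttau lam E (Suc k) (\<omega>', \<omega>h) then 1 else 0)
                              * \<phi> (uext lam E N k u (\<omega>', \<omega>h)) \<omega>' \<partial>Ph)
                 else \<phi> u \<omega>') \<omega>"
  shows "AE x in (P \<Otimes>\<^sub>M Ph).
     real_cond_exp (P \<Otimes>\<^sub>M Ph) (GN P Ph F lam E N t) Y x =
       (if t < tau lam E 1 x then 1 else 0) * exp (enn2real (cumhaz (lam 1) t (fst x)))
         * real_cond_exp P (F t)
             (\<lambda>\<omega>. \<integral>\<omega>h. (if t < tau lam E 1 (\<omega>, \<omega>h) then 1 else 0) * Y (\<omega>, \<omega>h) \<partial>Ph) (fst x)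
     + (\<Sum>k=1..N-1. (if tau lam E k x \<le> t \<and> t < tau lam E (Suc k) x then 1 else 0)
           * exp (enn2real (cumhaz (lam (Suc k)) (t - tau lam E k x) (fst x)))
           * g k (tauvec lam E k x) (fst x))
     + (if tau lam E N x \<le> t then 1 else 0) * g N (tauvec lam E N x) (fst x)"
proof -
  interpret default_claim P Ph F N E lam t Y \<phi> g
    by (intro default_claim.intro default_times.intro default_claim_axioms.intro) (fact assms)+
  show ?thesis by (rule cond_exp_formula)
qed

end
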